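(* Let $n\ge 0$ be an integer and let $G$ be a good bipartite graph (in the sense defined in the context) which has exactly $n$ four-cycles, $2n+2$ vertices and $3n+1$ edges. Then the Hilbert-Samuel multiplicity $\mathbf{e}$ of $R=K[x_1,\dots,x_{3n+1}]/I(G)$ at the origin, i.e. with respect to the maximal ideal $\mathfrak m=\langle x_1,\dots,x_{3n+1}\rangle$, is $\mathbf{e}=2^n$.
   Context: $K$ is a field and $G$ is a finite simple connected bipartite graph with vertex set $V(G)=\{1,\dots,v\}$ and $N\geq 1$ edges $e_1,\dots,e_N$ (in the claim $v=2n+2$ and $N=3n+1$). A variable $x_i$ is attached to each edge $e_i$. The toric ideal $I(G)\subset K[x_1,\dots,x_N]$ is the kernel of the $K$-algebra homomorphism $K[x_1,\dots,x_N]\to K[t_1,\dots,t_v]$ sending $x_i$ to $t_at_b$ when $e_i=\{a,b\}$. It is assumed that $I(G)$ is generated by quadratic binomials. Let $p$ be the number of 4-cycles of $G$ (as subgraphs; in the claim $p=n$). A 4-cycle with consecutive edges $(e_a,e_b,e_c,e_d)$ gives the binomial $x_ax_c-x_bx_d\in I(G)$. For the $i$-th 4-cycle, one of its two monomials $x_ax_c$, $x_bx_d$ is chosen and called $z_i$ (the non-standard one); the other is called $w_i$; put $f_i=w_i-z_i$, so that $I(G)=\langle f_1,\dots,f_p\rangle$. The graph $G$ (with $I(G)$ generated by quadratic binomials) is called good if these choices can be made so that: (a) the monomials $z_1,\dots,z_p$ are pairwise coprime; and (b) for every $t\ge 1$ and all indices $i_1,\dots,i_t\in\{1,\dots,p\}$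 (not necessarily distinct), $\prod_{s=1}^t w_{i_s}\ne\prod_{s=1}^t z_{i_s}$ as monomials in $K[x_1,\dots,x_N]$. Hilbert-Samuel multiplicity: if $R$ has Krull dimension $d+1$ at $\mathfrak m$ and $P(k)$ is the polynomial that agrees with $\dim_K \mathfrak m^k/\mathfrak m^{k+1}$ for all large $k$, then $\mathbf{e}$ is $d!$ times the coefficient of $k^d$ in $P$. *)

theory Defs
  imports
    "HOL-Library.Poly_Mapping"
    "HOL-Library.Extended_Nat"
    "HOL-Computational_Algebra.Polynomial"
    "HOL-Algebra.QuotRing"
    "HOL-Algebra.Ideal_Product"
    "HOL-Algebra.Embedded_Algebras"
begin

section \<open>Polynomial rings in finitely many variables\<close>

text \<open>
  A monomial is its exponent vector \<open>nat \<Rightarrow>\<^sub>0 nat\<close>, so that the product of monomials is the sum of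
  exponent vectors. A polynomial is a finitely supported map from monomials to coefficients, with
  the (convolution) ring operations of \<open>Poly_Mapping\<close>.
\<close>

type_synonym monomial = "nat \<Rightarrow>\<^sub>0 nat"
type_synonym 'k mpoly = "monomial \<Rightarrow>\<^sub>0 'k"

definition mvar :: "nat \<Rightarrow> monomial" where
  "mvar i = Poly_Mapping.single i 1"

definition Var :: "nat \<Rightarrow> 'k::field mpoly" where
  "Var i = Poly_Mapping.single (mvar i) 1"

definition Const :: "'k::field \<Rightarrow> 'k mpoly" where
  "Const c = Poly_Mapping.single 0 c"

text \<open>\<open>mpoly_ring r\<close> is \<open>K[x\<^sub>1, \<dots>, x\<^sub>r]\<close>, as a ring with carrier.\<close>

definition mpoly_ring :: "nat \<Rightarrow> 'k::field mpoly ring" where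
  "mpoly_ring r =
     \<lparr> carrier = {p. \<forall>m \<in> Poly_Mapping.keys p. Poly_Mapping.keys m \<subseteq> {1..r}},
       mult = (*), one = 1, zero = 0, add = (+) \<rparr>"

section \<open>Graphs and their toric ideals\<close>

text \<open>
  The vertices are \<open>1, \<dots>, v\<close>, and \<open>e i\<close> is the set of the two end points of the \<open>i\<close>-th edge,
  for \<open>i = 1, \<dots>, N\<close>.
\<close>

locale connected_bipartite_graph =
  fixes v N :: nat and e :: "nat \<Rightarrow> nat set"
  assumes at_least_one_edge: "N \<ge> 1"
    and edge: "i \<in> {1..N} \<Longrightarrow> e i \<subseteq> {1..v} \<and> card (e i) = 2"
    and edges_distinct: "inj_on e {1..N}"
    and connected: "\<lbrakk>a \<in> {1..v}; b \<in> {1..v}\<rbrakk> \<Longrightarrow> (a, b) \<in> {(a, b). {a, b} \<in> e ` {1..N}}\<^sup>*"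
    and bipartite: "\<exists>A B. A \<union> B = {1..v} \<and> A \<inter> B = {} \<and>
                      (\<forall>i \<in> {1..N}. card (e i \<inter> A) = 1 \<and> card (e i \<inter> B) = 1)"

text \<open>The \<open>K\<close>-algebra homomorphism sending \<open>x\<^sub>i\<close> to \<open>t\<^sub>a t\<^sub>b\<close> if \<open>e i = {a, b}\<close>.\<close>

definition toric_hom :: "(nat \<Rightarrow> nat set) \<Rightarrow> 'k::field mpoly \<Rightarrow> 'k mpoly" where
  "toric_hom e p =
     (\<Sum>m \<in> Poly_Mapping.keys p. Const (Poly_Mapping.lookup p m) *
        (\<Prod>i \<in> Poly_Mapping.keys m. (\<Prod>a \<in> e i. Var a) ^ Poly_Mapping.lookup m i))"

definition toric_ideal :: "nat \<Rightarrow> nat \<Rightarrow> (nat \<Rightarrow> nat set) \<Rightarrow> 'k::field mpoly set" where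
  "toric_ideal v N e = a_kernel (mpoly_ring N) (mpoly_ring v) (toric_hom e)"

definition quadratic_binomial :: "nat \<Rightarrow> 'k::field mpoly \<Rightarrow> bool" where
  "quadratic_binomial N f \<longleftrightarrow>
     (\<exists>a \<in> {1..N}. \<exists>b \<in> {1..N}. \<exists>c \<in> {1..N}. \<exists>d \<in> {1..N}.
        f = Var a * Var b - Var c * Var d \<and> f \<noteq> 0)"

definition generated_by_quadratic_binomials :: "nat \<Rightarrow> 'k::field mpoly set \<Rightarrow> bool" where
  "generated_by_quadratic_binomials N I \<longleftrightarrow>
     (\<exists>B. (\<forall>f \<in> B. quadratic_binomial N f) \<and> I = genideal (mpoly_ring N) B)"

section \<open>Four-cycles and good graphs\<close>

definition consecutive_in_4cycle ::
  "nat \<Rightarrow> (nat \<Rightarrow> nat set) \<Rightarrow> nat \<Rightarrow> nat \<Rightarrow> nat \<Rightarrow> nat \<Rightarrow> bool" where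
  "consecutive_in_4cycle N e a b c d \<longleftrightarrow> {a, b, c, d} \<subseteq> {1..N} \<and>
     (\<exists>p q r s. distinct [p, q, r, s] \<and>
        e a = {p, q} \<and> e b = {q, r} \<and> e c = {r, s} \<and> e d = {s, p})"

text \<open>A four-cycle, being a subgraph without isolated vertices, is given by its set of edges.\<close>

definition four_cycles :: "nat \<Rightarrow> (nat \<Rightarrow> nat set) \<Rightarrow> nat set set" where
  "four_cycles N e = {{a, b, c, d} | a b c d. consecutive_in_4cycle N e a b c d}"

text \<open>
  Both choices of \<open>z C\<close> among the two monomials of a four-cycle \<open>C\<close> are allowed by \<open>good_graph\<close>,
  since the edges of \<open>C\<close> may be listed cyclically starting from any of them. Sums of exponent
  vectors are products of monomials, and disjoint supports mean coprime monomials.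
\<close>

definition good_graph :: "nat \<Rightarrow> (nat \<Rightarrow> nat set) \<Rightarrow> bool" where
  "good_graph N e \<longleftrightarrow> (\<exists>w z :: nat set \<Rightarrow> monomial.
     (\<forall>C \<in> four_cycles N e. \<exists>a b c d. consecutive_in_4cycle N e a b c d \<and> C = {a, b, c, d} \<and>
         z C = mvar a + mvar c \<and> w C = mvar b + mvar d) \<and>
     (\<forall>C \<in> four_cycles N e. \<forall>D \<in> four_cycles N e. C \<noteq> D \<longrightarrow>
         Poly_Mapping.keys (z C) \<inter> Poly_Mapping.keys (z D) = {}) \<and>
     (\<forall>Cs. Cs \<noteq> [] \<and> set Cs \<subseteq> four_cycles N e \<longrightarrow>
         (\<Sum>C\<leftarrow>Cs. w C) \<noteq> (\<Sum>C\<leftarrow>Cs. z C)))"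

section \<open>Hilbert--Samuel multiplicity\<close>

text \<open>
  The Krull dimension of \<open>R\<close> at \<open>\<mm>\<close> is that of the localization of \<open>R\<close> at \<open>\<mm>\<close>, whose prime ideals
  correspond to the prime ideals of \<open>R\<close> contained in \<open>\<mm>\<close>.
\<close>

definition prime_chain_in :: "('a, 'b) ring_scheme \<Rightarrow> 'a set \<Rightarrow> nat \<Rightarrow> (nat \<Rightarrow> 'a set) \<Rightarrow> bool" where
  "prime_chain_in R \<mm> l p \<longleftrightarrow>
     (\<forall>i \<le> l. primeideal (p i) R \<and> p i \<subseteq> \<mm>) \<and> (\<forall>i < l. p i \<subset> p (Suc i))"

definition krull_dim_at :: "('a, 'b) ring_scheme \<Rightarrow> 'a set \<Rightarrow> enat" where
  "krull_dim_at R \<mm> = Sup {enat l | l. \<exists>p. prime_chain_in R \<mm> l p}"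

text \<open>
  Powers of \<open>\<mm>\<close> are taken in the semiring of ideals of \<open>R\<close>. The space \<open>\<mm>\<^sup>k / \<mm>\<^sup>k\<^sup>+\<^sup>1\<close> is the image of \<open>\<mm>\<^sup>k\<close>
  in the ring \<open>R / \<mm>\<^sup>k\<^sup>+\<^sup>1\<close>, and the subfield \<open>K\<close> of \<open>R\<close> acts on it through its image in \<open>R / \<mm>\<^sup>k\<^sup>+\<^sup>1\<close>.
\<close>

definition graded_piece_dimension ::
  "('a, 'b) ring_scheme \<Rightarrow> 'a set \<Rightarrow> 'a set \<Rightarrow> nat \<Rightarrow> nat \<Rightarrow> bool" where
  "graded_piece_dimension R K \<mm> k h \<longleftrightarrow>
     (let J = \<mm> [^]\<^bsub>ideals_set R\<^esub> (k + 1);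
          \<pi> = (\<lambda>x. J +>\<^bsub>R\<^esub> x)
      in ring.dimension (R Quot J) h (\<pi> ` K) (\<pi> ` (\<mm> [^]\<^bsub>ideals_set R\<^esub> k)))"

definition has_hilbert_samuel_multiplicity ::
  "('a, 'b) ring_scheme \<Rightarrow> 'a set \<Rightarrow> 'a set \<Rightarrow> nat \<Rightarrow> bool" where
  "has_hilbert_samuel_multiplicity R K \<mm> \<e> \<longleftrightarrow>
     (\<exists>d (P :: rat poly).
        krull_dim_at R \<mm> = enat (d + 1) \<and>
        (\<exists>k0. \<forall>k \<ge> k0. \<exists>h. graded_piece_dimension R K \<mm> k h \<and> of_nat h = poly P (of_nat k)) \<and>
        of_nat \<e> = fact d * Polynomial.coeff P d)"

section \<open>The toric ring at the origin\<close>

definition toric_ring :: "nat \<Rightarrow> nat \<Rightarrow> (nat \<Rightarrow> nat set) \<Rightarrow> 'k::field mpoly set ring" where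
  "toric_ring v N e = mpoly_ring N Quot toric_ideal v N e"

definition toric_constants :: "nat \<Rightarrow> nat \<Rightarrow> (nat \<Rightarrow> nat set) \<Rightarrow> 'k::field mpoly set set" where
  "toric_constants v N e = (\<lambda>c. toric_ideal v N e +>\<^bsub>mpoly_ring N\<^esub> Const c) ` UNIV"

definition toric_origin :: "nat \<Rightarrow> nat \<Rightarrow> (nat \<Rightarrow> nat set) \<Rightarrow> 'k::field mpoly set set" where
  "toric_origin v N e =
     genideal (toric_ring v N e) ((\<lambda>i. toric_ideal v N e +>\<^bsub>mpoly_ring N\<^esub> Var i) ` {1..N})"

end

theory Submission
  imports Defs "HOL-Library.Confluence"
begin

text \<open>
  The toric ring is the span of the monomials \<open>t\<^bsup>E m\<^esup>\<close>, where \<open>E m\<close> is the sum of the incidence vectors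
  of the edges in \<open>m\<close>, so \<open>\<mm>\<^sup>k / \<mm>\<^sup>k\<^sup>+\<^sup>1\<close> has as basis the distinct \<open>E m\<close> with \<open>m\<close> of degree \<open>k\<close>. To count them, rewrite
  every \<open>z\<^sub>i\<close> to \<open>w\<^sub>i\<close>. Condition (b) of goodness excludes cycles, hence rewriting terminates; coprimality of
  the \<open>z\<^sub>i\<close> makes it confluent; and since the binomials generate the ideal, two monomials with the same
  \<open>E m\<close> have the same normal form. The Hilbert function therefore counts the monomials divisible by
  none of the \<open>n\<close> coprime square-free quadrics \<open>z\<^sub>i\<close>, with Hilbert series
  \<open>(1 + s)\<^sup>n / (1 - s)\<^sup>2\<^sup>n\<^sup>+\<^sup>1\<close>, which gives a polynomial of degree \<open>2 n\<close> with leading coefficient \<open>2\<^sup>n / (2 n)!\<close>.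

  The Krull dimension is \<open>v - 1\<close> for every connected bipartite graph. Elements
  \<open>f\<^sub>i \<in> \<pp>\<^sub>i\<^sub>+\<^sub>1 - \<pp>\<^sub>i\<close> from a chain of primes are algebraically independent, and the number of available
  exponents \<open>E m\<close> grows only like the power \<open>v - 1\<close>. Conversely, adding the vertices one by one, each
  adjacent to an earlier one, gives a chain of face ideals of length \<open>v - 1\<close>.
\<close>

text \<open>The multiplicity links two numbers that are computed separately. The Hilbert polynomial
  depends on the edges and four-cycles: each of the \<open>n\<close> coprime quadrics contributes a
  factor \<open>1 - s^2\<close>, and \<open>(1 - s^2)^n / (1 - s)^(3n+1)\<close> has a pole of order
  \<open>2n + 1\<close>. The Krull dimension depends on the vertices. The hypothesis
  \<open>v = 2 * n + 2\<close> makes the dimension equal to the pole order, so that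
  \<open>d = 2 * n\<close> and \<open>fact d\<close> cancels the denominator of the leading
  coefficient.

  Questions about the quotient are settled in the target of \<open>toric_hom\<close>: classes agree
  exactly when their images do, and since an edge has two ends, the order of a class is half the
  order of its image. Rewriting serves only to count exponents. There the obstacle is that the
  generating binomials are not given explicitly; bipartiteness forces each of them to come from a
  four-cycle.\<close>

abbreviation lookup :: "('a \<Rightarrow>\<^sub>0 'b::zero) \<Rightarrow> 'a \<Rightarrow> 'b" where
  "lookup \<equiv> Poly_Mapping.lookup"

abbreviation keys :: "('a \<Rightarrow>\<^sub>0 'b::zero) \<Rightarrow> 'a set" where
  "keys \<equiv> Poly_Mapping.keys"

abbreviation monom_of :: "monomial \<Rightarrow> 'k::field mpoly" where
  "monom_of m \<equiv> Poly_Mapping.single m 1"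

section \<open>Monomials\<close>

definition tdeg :: "monomial \<Rightarrow> nat" where
  "tdeg m = (\<Sum>i\<in>keys m. lookup m i)"

text \<open>This is the map \<open>E\<close> of the overview. Summing over the support of
  \<open>m\<close> keeps the number of edges out of the definition.\<close>

definition toric_exp :: "(nat \<Rightarrow> nat set) \<Rightarrow> monomial \<Rightarrow> monomial" where
  "toric_exp e m = (\<Sum>i\<in>keys m. \<Sum>a\<in>e i. Poly_Mapping.single a (lookup m i))"

lemma tdeg_zero [simp]: "tdeg 0 = 0"
  by (simp add: tdeg_def)

lemma tdeg_add: "tdeg (a + b) = tdeg a + tdeg b"
  unfolding tdeg_def by (rule setsum_keys_plus_distrib) auto

lemma tdeg_sum: "tdeg (sum f A) = (\<Sum>i\<in>A. tdeg (f i))"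
  by (induction A rule: infinite_finite_induct) (auto simp: tdeg_add)

lemma tdeg_single [simp]: "tdeg (Poly_Mapping.single a j) = j"
  by (simp add: tdeg_def)

lemma tdeg_mvar [simp]: "tdeg (mvar i) = 1"
  by (simp add: mvar_def)

lemma keys_eq_empty_iff [simp]: "keys (p :: 'a \<Rightarrow>\<^sub>0 'b::zero) = {} \<longleftrightarrow> p = 0"
  by (metis lookup_eq_zero_in_keys_contradict empty_iff keys_zero lookup_zero not_in_keys_iff_lookup_eq_zero poly_mapping_eqI)

lemma tdeg_eq_0_iff [simp]: "tdeg m = 0 \<longleftrightarrow> m = 0"
proof
  assume "tdeg m = 0"
  then have "\<forall>i\<in>keys m. lookup m i = 0"
    by (simp add: tdeg_def)
  then have "keys m = {}"
    by (metis all_not_in_conv in_keys_iff)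
  then show "m = 0" by simp
qed simp

lemma toric_exp_zero [simp]: "toric_exp e 0 = 0"
  by (simp add: toric_exp_def)

lemma toric_exp_add: "toric_exp e (a + b) = toric_exp e a + toric_exp e b"
  unfolding toric_exp_def
  by (rule setsum_keys_plus_distrib) (auto simp: single_add sum.distrib)

lemma toric_exp_mvar: "toric_exp e (mvar i) = (\<Sum>a\<in>e i. mvar a)"
  by (simp add: toric_exp_def mvar_def)

lemma lookup_mvar: "lookup (mvar i) j = (if i = j then 1 else 0)"
  by (simp add: mvar_def lookup_single when_def)

lemma keys_mvar [simp]: "keys (mvar i) = {i}"
  by (simp add: mvar_def)

lemma keys_plus_monomial: "keys (a + b) = keys a \<union> keys (b :: monomial)"
  by (auto simp: in_keys_iff lookup_add)

lemma keys_sum_monomial: "finite A \<Longrightarrow> keys (sum f A) = (\<Union>i\<in>A. keys (f i :: monomial))"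
  by (induction A rule: finite_induct) (auto simp: keys_plus_monomial)

lemma keys_minus_monomial: "keys (a - b) \<subseteq> keys (a :: monomial)"
  by (auto simp: in_keys_iff lookup_minus)

text \<open>Subtraction of exponents truncates at zero, so dividing by a variable can be undone only
  if the variable occurs.\<close>

lemma split_mvar:
  assumes "i \<in> keys (m :: monomial)"
  shows "(m - mvar i) + mvar i = m"
proof (rule poly_mapping_eqI)
  fix j
  show "lookup ((m - mvar i) + mvar i) j = lookup m j"
    using assms by (auto simp: lookup_add lookup_minus lookup_mvar in_keys_iff)
qed

lemma monomial_induct [case_names zero add_var]:
  assumes "P (0 :: monomial)" "\<And>m i. i \<in> keys (m + mvar i) \<Longrightarrow> P m \<Longrightarrow> P (m + mvar i)"
  shows "P m"
proof (induction "tdeg m" arbitrary: m)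
  case 0
  then show ?case using assms(1) by simp
next
  case (Suc n)
  then have "m \<noteq> 0" by auto
  then have "keys m \<noteq> {}" by simp
  then obtain i where i: "i \<in> keys m" by blast
  have "tdeg (m - mvar i) + 1 = tdeg m"
    using tdeg_add[of "m - mvar i" "mvar i"] by (simp add: split_mvar[OF i])
  with Suc have "P (m - mvar i)" by simp
  then show ?case using assms(2)[of i "m - mvar i"] i by (simp add: split_mvar[OF i])
qed

section \<open>Polynomials\<close>

lemma mpoly_expand:
  assumes "finite S" "keys p \<subseteq> S"
  shows "p = (\<Sum>m\<in>S. Poly_Mapping.single m (lookup p m))"
proof (rule poly_mapping_eqI)
  fix k
  have "lookup (\<Sum>m\<in>S. Poly_Mapping.single m (lookup p m)) k = (\<Sum>m\<in>S. if m = k then lookup p m else 0)"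
    by (simp add: lookup_sum lookup_single when_def)
  also have "\<dots> = lookup p k"
    using assms by (auto simp: sum.delta in_keys_iff)
  finally show "lookup p k = lookup (\<Sum>m\<in>S. Poly_Mapping.single m (lookup p m)) k" by simp
qed

lemma mpoly_expand_keys: "p = (\<Sum>m\<in>keys p. Poly_Mapping.single m (lookup p m))"
  by (rule mpoly_expand) auto

lemma Const_mult_single: "Const c * Poly_Mapping.single m x = Poly_Mapping.single m (c * x)"
  by (simp add: Const_def mult_single)

lemma lookup_Const_mult [simp]: "lookup (Const c * p) m = c * lookup p m"
  unfolding Const_def by (simp flip: mult_map_scale_conv_mult add: map.rep_eq when_def)

lemma Const_add: "Const (a + b) = Const a + Const b"
  by (simp add: Const_def single_add)

lemma Const_mult: "Const (a * b) = Const a * Const b"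
  by (simp add: Const_def mult_single)

lemma Const_zero [simp]: "Const 0 = 0"
  by (simp add: Const_def)

lemma Const_one [simp]: "Const 1 = 1"
  by (simp add: Const_def)

lemma prod_monom_of: "(\<Prod>i\<in>A. monom_of (f i)) = monom_of (\<Sum>i\<in>A. f i)"
  by (induction A rule: infinite_finite_induct) (auto simp: mult_single)

lemma power_monom_of: "monom_of m ^ j = monom_of (\<Sum>i<j. m)"
  by (induction j) (simp_all add: mult_single add.commute del: sum_constant)

text \<open>The \<open>K\<close>-linear extension of a map on monomials. Both
  \<open>toric_hom\<close> and its composition with setting some vertex variables to zero have this
  form, so for each of them the homomorphism property reduces to multiplicativity on
  monomials.\<close>

definition lin_ext :: "(monomial \<Rightarrow> 'k::field mpoly) \<Rightarrow> 'k mpoly \<Rightarrow> 'k mpoly" where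
  "lin_ext g p = (\<Sum>m\<in>keys p. Const (lookup p m) * g m)"

lemma lin_ext_add: "lin_ext g (p + q) = lin_ext g p + lin_ext g q"
  unfolding lin_ext_def
  by (rule setsum_keys_plus_distrib[where f = "\<lambda>m c. Const c * g m"])
    (auto simp: Const_add distrib_right)

lemma lin_ext_zero [simp]: "lin_ext g 0 = 0"
  by (simp add: lin_ext_def)

lemma lin_ext_sum: "lin_ext g (sum f A) = (\<Sum>i\<in>A. lin_ext g (f i))"
  by (induction A rule: infinite_finite_induct) (auto simp: lin_ext_add)

lemma lin_ext_single: "lin_ext g (Poly_Mapping.single m c) = Const c * g m"
  by (auto simp: lin_ext_def)

lemma lin_ext_diff: "lin_ext g (p - q) = lin_ext g p - lin_ext g q"
  using lin_ext_add[of g "p - q" q] by (simp add: algebra_simps)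

lemma lin_ext_mult:
  assumes "\<And>a b. g (a + b) = g a * g b"
  shows "lin_ext g (p * q) = lin_ext g p * lin_ext g q"
proof -
  have "p * q = (\<Sum>a\<in>keys p. \<Sum>b\<in>keys q. Poly_Mapping.single a (lookup p a) * Poly_Mapping.single b (lookup q b))"
    unfolding sum_product[symmetric]
    by (simp only: mpoly_expand_keys[symmetric])
  then have "lin_ext g (p * q) =
      (\<Sum>a\<in>keys p. \<Sum>b\<in>keys q. Const (lookup p a) * g a * (Const (lookup q b) * g b))"
    by (simp only: lin_ext_sum mult_single lin_ext_single Const_mult assms) (simp add: ac_simps)
  then show ?thesis
    by (simp add: lin_ext_def sum_product)
qed

lemma keys_lin_ext: "keys (lin_ext g p) \<subseteq> (\<Union>m\<in>keys p. keys (g m))"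
proof -
  have "keys (lin_ext g p) \<subseteq> (\<Union>m\<in>keys p. keys (Const (lookup p m) * g m))"
    unfolding lin_ext_def by (rule keys_sum)
  also have "\<dots> \<subseteq> (\<Union>m\<in>keys p. keys (g m))"
    by (auto simp: in_keys_iff)
  finally show ?thesis .
qed

lemma toric_hom_eq: "toric_hom e = lin_ext (\<lambda>m. monom_of (toric_exp e m))"
proof (rule ext)
  fix p :: "'k::field mpoly"
  have "(\<Prod>a\<in>A. Var a) ^ j = (monom_of (\<Sum>a\<in>A. Poly_Mapping.single a j) :: 'k mpoly)" for A j
  proof -
    have "(\<Sum>i<j. \<Sum>a\<in>A. mvar a) = (\<Sum>a\<in>A. Poly_Mapping.single a j)"
      by (subst sum.swap, rule sum.cong)
        (auto intro!: poly_mapping_eqI simp: lookup_single mvar_def when_def lookup_sum simp del: sum_constant, simp)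
    then show ?thesis
      by (simp add: Var_def prod_monom_of power_monom_of)
  qed
  then show "toric_hom e p = lin_ext (\<lambda>m. monom_of (toric_exp e m)) p"
    by (simp add: toric_hom_def lin_ext_def toric_exp_def prod_monom_of)
qed

text \<open>Monomials go to monomials, so terms collect along the fibres of
  \<open>toric_exp\<close>: a polynomial is killed exactly when its coefficients sum to zero over
  every fibre.\<close>

lemma lookup_toric_hom:
  "lookup (toric_hom e p) u = (\<Sum>m\<in>{m \<in> keys p. toric_exp e m = u}. lookup p m)"
  unfolding toric_hom_eq lin_ext_def lookup_sum
  by (simp add: lookup_single when_def sum.inter_filter if_distrib cong: if_cong)

lemma toric_hom_add: "toric_hom e (p + q) = toric_hom e p + toric_hom e q"
  by (simp add: toric_hom_eq lin_ext_add)

lemma toric_hom_diff: "toric_hom e (p - q) = toric_hom e p - toric_hom e q"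
  by (simp add: toric_hom_eq lin_ext_diff)

lemma toric_hom_mult: "toric_hom e (p * q) = toric_hom e p * toric_hom e q"
  unfolding toric_hom_eq by (rule lin_ext_mult) (simp add: toric_exp_add mult_single)

lemma toric_hom_single:
  "toric_hom e (Poly_Mapping.single m c) = Poly_Mapping.single (toric_exp e m) c"
  by (simp add: toric_hom_eq lin_ext_single Const_mult_single)

lemma toric_hom_one [simp]: "toric_hom e 1 = 1"
  using toric_hom_single[of e 0 1] by simp

lemma toric_hom_zero [simp]: "toric_hom e 0 = 0"
  by (simp add: toric_hom_eq)

lemma keys_toric_hom: "keys (toric_hom e p) \<subseteq> toric_exp e ` keys p"
  unfolding toric_hom_eq using keys_lin_ext[of "\<lambda>m. monom_of (toric_exp e m)" p] by auto

section \<open>The ring of polynomials\<close>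

lemma mpoly_ring_simps [simp]:
  "mult (mpoly_ring r) = (*)" "one (mpoly_ring r) = 1"
  "zero (mpoly_ring r) = 0" "add (mpoly_ring r) = (+)"
  by (simp_all add: mpoly_ring_def)

lemma mpoly_ring_carrier:
  "carrier (mpoly_ring r) = {p. \<forall>m \<in> keys p. keys m \<subseteq> {1..r}}"
  by (simp add: mpoly_ring_def)

lemma mpoly_add_closed:
  "p \<in> carrier (mpoly_ring r) \<Longrightarrow> q \<in> carrier (mpoly_ring r) \<Longrightarrow> p + q \<in> carrier (mpoly_ring r)"
  using keys_add[of p q] by (auto simp: mpoly_ring_carrier)

lemma mpoly_mult_closed:
  assumes "p \<in> carrier (mpoly_ring r)" "q \<in> carrier (mpoly_ring r)"
  shows "p * q \<in> carrier (mpoly_ring r)"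
  unfolding mpoly_ring_carrier
proof (safe)
  fix m x assume m: "m \<in> keys (p * q)" "x \<in> keys m"
  then obtain a b where "m = a + b" "a \<in> keys p" "b \<in> keys q"
    using keys_mult[of p q] by blast
  with m have "x \<in> keys a \<union> keys b" by (simp add: keys_plus_monomial)
  with assms \<open>a \<in> keys p\<close> \<open>b \<in> keys q\<close> show "x \<in> {1..r}"
    by (auto simp only: mpoly_ring_carrier)
qed

lemma keys_uminus_mpoly [simp]: "keys (- p) = keys (p :: 'k::field mpoly)"
  by (auto simp: in_keys_iff)

lemma mpoly_uminus_closed:
  "p \<in> carrier (mpoly_ring r) \<Longrightarrow> - p \<in> carrier (mpoly_ring r)"
  by (auto simp: mpoly_ring_carrier)

lemma mpoly_diff_closed:
  "p \<in> carrier (mpoly_ring r) \<Longrightarrow> q \<in> carrier (mpoly_ring r) \<Longrightarrow> p - q \<in> carrier (mpoly_ring r)"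
  using mpoly_add_closed[of p r "-q"] mpoly_uminus_closed[of q r] by simp

lemma mpoly_single_closed [simp]:
  "keys m \<subseteq> {1..r} \<Longrightarrow> Poly_Mapping.single m c \<in> carrier (mpoly_ring r)"
  by (auto simp: mpoly_ring_carrier)

lemma mpoly_Const_closed [simp]: "Const c \<in> carrier (mpoly_ring r)"
  by (simp add: Const_def)

lemma mpoly_zero_closed [simp]: "0 \<in> carrier (mpoly_ring r)"
  by (simp add: mpoly_ring_carrier)

lemma mpoly_one_closed [simp]: "1 \<in> carrier (mpoly_ring r)"
  using mpoly_Const_closed[of 1 r] by simp

lemma mpoly_sum_closed:
  "(\<And>i. i \<in> A \<Longrightarrow> f i \<in> carrier (mpoly_ring r)) \<Longrightarrow> sum f A \<in> carrier (mpoly_ring r)"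
  by (induction A rule: infinite_finite_induct) (auto simp: mpoly_add_closed)

lemma mpoly_ring_cring: "cring (mpoly_ring r :: 'k::field mpoly ring)"
proof (rule cringI)
  show "abelian_group (mpoly_ring r :: 'k mpoly ring)"
  proof (rule abelian_groupI, goal_cases)
    case (6 x)
    then show ?case
      by (intro bexI[of _ "-x"]) (auto intro: mpoly_uminus_closed)
  qed (auto simp: mpoly_add_closed ac_simps)
  show "comm_monoid (mpoly_ring r :: 'k mpoly ring)"
    by (rule comm_monoidI) (auto simp: mpoly_mult_closed ac_simps)
qed (auto simp: distrib_right)

lemma mpoly_ring_domain: "domain (mpoly_ring r :: 'k::field mpoly ring)"
proof -
  interpret cring "mpoly_ring r :: 'k mpoly ring" by (rule mpoly_ring_cring)
  show ?thesis by unfold_locales auto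
qed

lemma mpoly_ring_a_inv:
  assumes "p \<in> carrier (mpoly_ring r)"
  shows "\<ominus>\<^bsub>mpoly_ring r\<^esub> p = - (p :: 'k::field mpoly)"
proof -
  interpret cring "mpoly_ring r :: 'k mpoly ring" by (rule mpoly_ring_cring)
  show ?thesis
    using assms mpoly_uminus_closed[OF assms] by (intro minus_equality) auto
qed

lemma mpoly_idealI:
  fixes I :: "'k::field mpoly set"
  assumes carrier: "I \<subseteq> carrier (mpoly_ring r)" and zero: "0 \<in> I"
    and add: "\<And>f g. \<lbrakk>f \<in> I; g \<in> I\<rbrakk> \<Longrightarrow> f + g \<in> I"
    and mult: "\<And>f g. \<lbrakk>f \<in> carrier (mpoly_ring r); g \<in> I\<rbrakk> \<Longrightarrow> f * g \<in> I"
  shows "ideal I (mpoly_ring r)"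
proof -
  interpret cring "mpoly_ring r :: 'k mpoly ring" by (rule mpoly_ring_cring)
  show ?thesis
  proof (rule idealI)
    show "subgroup I (add_monoid (mpoly_ring r))"
    proof (rule add.subgroupI)
      show "\<ominus>\<^bsub>mpoly_ring r\<^esub> f \<in> I" if "f \<in> I" for f
      proof -
        have "- 1 * f \<in> I" by (intro mult mpoly_uminus_closed mpoly_one_closed that)
        moreover have "f \<in> carrier (mpoly_ring r)" using carrier that by blast
        ultimately show ?thesis by (simp add: mpoly_ring_a_inv)
      qed
    qed (use carrier zero add in auto)
    show "x \<otimes>\<^bsub>mpoly_ring r\<^esub> f \<in> I" "f \<otimes>\<^bsub>mpoly_ring r\<^esub> x \<in> I"
      if "f \<in> I" "x \<in> carrier (mpoly_ring r)" for f x
      using mult[OF that(2,1)] by (simp_all add: mult.commute[of f x])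
  qed (rule ring_axioms)
qed

lemma mpoly_ring_hom_lin_ext:
  fixes g :: "monomial \<Rightarrow> 'k::field mpoly"
  assumes "\<And>a b. g (a + b) = g a * g b" "g 0 = 1"
    and "\<And>m. keys m \<subseteq> {1..N} \<Longrightarrow> g m \<in> carrier (mpoly_ring v)"
  shows "ring_hom_ring (mpoly_ring N) (mpoly_ring v) (lin_ext g)"
proof (rule ring_hom_ringI)
  show "ring (mpoly_ring N :: 'k mpoly ring)" "ring (mpoly_ring v :: 'k mpoly ring)"
    using mpoly_ring_cring cring.axioms(1) by blast+
  show "lin_ext g p \<in> carrier (mpoly_ring v)" if "p \<in> carrier (mpoly_ring N)" for p
    unfolding lin_ext_def using that assms(3)
    by (intro mpoly_sum_closed mpoly_mult_closed) (auto simp: mpoly_ring_carrier[of N])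
  show "lin_ext g \<one>\<^bsub>mpoly_ring N\<^esub> = \<one>\<^bsub>mpoly_ring v\<^esub>"
    using lin_ext_single[of g 0 1] assms(2) by simp
qed (auto simp: lin_ext_add lin_ext_mult[OF assms(1)])

section \<open>Counting square-free standard monomials\<close>

text \<open>The sets in \<open>Z\<close> stand for square-free monomials, for which divisibility is
  containment of supports.\<close>

definition std_monomials :: "nat set \<Rightarrow> nat set set \<Rightarrow> nat \<Rightarrow> monomial set" where
  "std_monomials X Z k = {m. keys m \<subseteq> X \<and> tdeg m = k \<and> (\<forall>p\<in>Z. \<not> p \<subseteq> keys m)}"

lemma finite_monomials_tdeg:
  assumes "finite X"
  shows "finite {m. keys m \<subseteq> X \<and> tdeg m = k}"
proof (induction k)
  case 0
  have "{m. keys m \<subseteq> X \<and> tdeg m = 0} \<subseteq> {0}" by auto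
  then show ?case using finite_subset by blast
next
  case (Suc k)
  have "{m. keys m \<subseteq> X \<and> tdeg m = Suc k} \<subseteq>
      (\<Union>i\<in>X. (\<lambda>m. m + mvar i) ` {m. keys m \<subseteq> X \<and> tdeg m = k})"
  proof safe
    fix m assume m: "keys m \<subseteq> X" "tdeg m = Suc k"
    then have "m \<noteq> 0" by auto
    then have "keys m \<noteq> {}" by simp
    then obtain i where i: "i \<in> keys m" by blast
    have "tdeg (m - mvar i) = k"
      using tdeg_add[of "m - mvar i" "mvar i"] m(2) by (simp add: split_mvar[OF i])
    moreover have "keys (m - mvar i) \<subseteq> X"
      using keys_minus_monomial m(1) by blast
    moreover have "m = m - mvar i + mvar i" by (simp add: split_mvar[OF i])
    ultimately show "m \<in> (\<Union>i\<in>X. (\<lambda>m. m + mvar i) ` {m. keys m \<subseteq> X \<and> tdeg m = k})"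
      using i m(1) by blast
  qed
  then show ?case
    by (rule finite_subset) (use assms Suc in auto)
qed

lemma finite_std_monomials: "finite X \<Longrightarrow> finite (std_monomials X Z k)"
  by (rule finite_subset[OF _ finite_monomials_tdeg[of X k]]) (auto simp: std_monomials_def)

lemma std_monomials_degree_0: "{} \<notin> Z \<Longrightarrow> std_monomials X Z 0 = {0}"
  by (auto simp: std_monomials_def)

text \<open>
  Splits by whether \<open>c\<close> occurs. It is used both for a free variable \<open>c\<close>, with \<open>Y = X\<close>, and for a pair
  \<open>{a, c}\<close> in \<open>Z\<close>, with \<open>Y = X - {a}\<close>.
\<close>

lemma card_std_monomials_split:
  assumes "finite X" "c \<in> X"
    and absent: "\<And>m. c \<notin> keys m \<Longrightarrow> m \<in> std_monomials X Z (Suc k) \<longleftrightarrow> m \<in> std_monomials (X - {c}) Z' (Suc k)"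
    and present: "\<And>m. m + mvar c \<in> std_monomials X Z (Suc k) \<longleftrightarrow> m \<in> std_monomials Y Z' k"
    and Y: "Y \<subseteq> X"
  shows "card (std_monomials X Z (Suc k)) =
    card (std_monomials (X - {c}) Z' (Suc k)) + card (std_monomials Y Z' k)"
proof -
  let ?f = "\<lambda>m. m + mvar c"
  have eq: "std_monomials X Z (Suc k) = std_monomials (X - {c}) Z' (Suc k) \<union> ?f ` std_monomials Y Z' k"
  proof (intro equalityI subsetI)
    fix m assume m: "m \<in> std_monomials X Z (Suc k)"
    show "m \<in> std_monomials (X - {c}) Z' (Suc k) \<union> ?f ` std_monomials Y Z' k"
    proof (cases "c \<in> keys m")
      case True
      then have "m = ?f (m - mvar c)" by (simp add: split_mvar)
      then show ?thesis using present[of "m - mvar c"] m by auto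
    qed (use m absent in auto)
  next
    fix m assume "m \<in> std_monomials (X - {c}) Z' (Suc k) \<union> ?f ` std_monomials Y Z' k"
    then show "m \<in> std_monomials X Z (Suc k)"
    proof
      assume m: "m \<in> std_monomials (X - {c}) Z' (Suc k)"
      then have "c \<notin> keys m" by (auto simp: std_monomials_def)
      with m absent show ?thesis by blast
    qed (use present in auto)
  qed
  have "finite Y" using Y assms(1) finite_subset by blast
  then have fin: "finite (std_monomials (X - {c}) Z' (Suc k))" "finite (std_monomials Y Z' k)"
    using assms(1) by (auto intro: finite_std_monomials)
  have "std_monomials (X - {c}) Z' (Suc k) \<inter> ?f ` std_monomials Y Z' k = {}"
    by (auto simp: std_monomials_def keys_plus_monomial)
  then show ?thesis
    unfolding eq using fin by (simp add: card_Un_disjoint card_image inj_on_def)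
qed

text \<open>Pascal's rule: discarding a variable lowers \<open>d\<close> and dividing by it lowers
  \<open>k\<close>, so the induction runs on \<open>k + d\<close>.\<close>

lemma card_monomials_tdeg:
  assumes "finite X" "card X = Suc d"
  shows "card (std_monomials X {} k) = (k + d) choose d"
  using assms
proof (induction "k + d" arbitrary: k d X rule: less_induct)
  case less
  obtain x where x: "x \<in> X" using less.prems by (metis card_eq_SucD insertI1)
  show ?case
  proof (cases k)
    case 0
    then show ?thesis by (simp add: std_monomials_degree_0)
  next
    case (Suc k')
    have split: "card (std_monomials X {} (Suc k')) =
        card (std_monomials (X - {x}) {} (Suc k')) + card (std_monomials X {} k')"
      using x less.prems
      by (intro card_std_monomials_split)
        (auto simp: std_monomials_def keys_plus_monomial tdeg_add)
    have b: "card (std_monomials X {} k') = (k' + d) choose d"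
      using less Suc by auto
    show ?thesis
    proof (cases d)
      case 0
      have "X - {x} = {}" using less.prems x 0 by (auto simp: card_Suc_eq)
      then have "std_monomials (X - {x}) {} (Suc k') = {}"
        unfolding std_monomials_def by (metis (mono_tags, lifting) Collect_empty_eq keys_eq_empty_iff nat.distinct(1) subset_empty tdeg_zero)
      then show ?thesis using split b Suc 0 by simp
    next
      case (Suc d')
      have "card (X - {x}) = Suc d'" using less.prems x Suc by simp
      then have "card (std_monomials (X - {x}) {} (Suc k')) = (Suc k' + d') choose d'"
        using less.hyps[of "Suc k'" d' "X - {x}"] less.prems Suc \<open>k = Suc k'\<close> by simp
      then show ?thesis using split b Suc \<open>k = Suc k'\<close> by simp
    qed
  qed
qed

lemma binomial_poly:
  "\<exists>P :: rat poly. Polynomial.degree P \<le> d \<and> Polynomial.coeff P d = 1 / fact d \<and>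
     (\<forall>k. poly P (of_nat k) = of_nat ((k + d) choose d))"
proof (induction d)
  case 0
  show ?case by (intro exI[of _ "[:1:]"]) auto
next
  case (Suc d)
  then obtain P :: "rat poly" where P: "Polynomial.degree P \<le> d" "Polynomial.coeff P d = 1 / fact d"
    "\<And>k. poly P (of_nat k) = of_nat ((k + d) choose d)"
    by blast
  \<comment> \<open>Comes from \<open>(k + d + 1) choose (d + 1) = (k + d + 1) / (d + 1) * ((k + d)
    choose d)\<close>; the linear factor is \<open>X + (d + 1)\<close>.\<close>
  define Q where "Q = Polynomial.smult (1 / of_nat (Suc d)) ([:of_nat (Suc d), 1:] * P)"
  have "Polynomial.degree ([:of_nat (Suc d), 1:] * P) \<le> Polynomial.degree ([:of_nat (Suc d), 1 :: rat:]) + Polynomial.degree P"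
    by (rule Polynomial.degree_mult_le)
  also have "\<dots> \<le> Suc d" using P(1) by simp
  finally have "Polynomial.degree Q \<le> Suc d"
    unfolding Q_def using Polynomial.degree_smult_le le_trans by blast
  moreover have "Polynomial.coeff P (Suc d) = 0" using P(1) by (simp add: coeff_eq_0)
  then have "Polynomial.coeff Q (Suc d) = 1 / fact (Suc d)"
    by (simp add: Q_def P(2) field_simps)
  moreover have "poly Q (of_nat k) = of_nat ((k + Suc d) choose Suc d)" for k
  proof -
    have "Suc d * ((k + Suc d) choose Suc d) = (k + Suc d) * ((k + d) choose d)"
      using Suc_times_binomial[of d "k + d"] by simp
    then have "of_nat (Suc d) * (of_nat ((k + Suc d) choose Suc d) :: rat) =
        of_nat (k + Suc d) * of_nat ((k + d) choose d)"
      by (metis of_nat_mult)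
    then show ?thesis
      by (simp add: Q_def P(3) field_simps del: binomial_Suc_Suc)
  qed
  ultimately show ?case by blast
qed

text \<open>The recursion below evaluates one of its two polynomials at \<open>k - 1\<close>. Such a
  shift of the argument affects only the coefficients below the leading one, so the two leading
  coefficients simply add.\<close>

lemma coeff_pcompose_shift:
  fixes p :: "rat poly"
  assumes "Polynomial.degree p \<le> d"
  shows "Polynomial.coeff (pcompose p [:a, 1:]) d = Polynomial.coeff p d"
proof (cases "Polynomial.degree p = d")
  case True
  have "Polynomial.degree (pcompose p [:a, 1:]) = d" using True by (simp add: Polynomial.degree_pcompose)
  then show ?thesis
    using lead_coeff_comp[of "[:a, 1:]" p] True by simp
next
  case False
  then have "Polynomial.degree p < d" "Polynomial.degree (pcompose p [:a, 1:]) < d"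
    using assms by (auto simp: Polynomial.degree_pcompose)
  then show ?thesis by (simp only: Polynomial.coeff_eq_0)
qed

text \<open>For a pair \<open>{a, c}\<close> in \<open>Z\<close>, a standard monomial either avoids
  \<open>c\<close>, or is \<open>c\<close> times a standard monomial that avoids \<open>a\<close>.
  Both cases leave the other pairs and one variable fewer, so every pair doubles the leading
  coefficient. The second case also lowers the degree by one, whence the threshold
  \<open>card Z\<close>.\<close>

theorem card_std_monomials_poly:
  assumes "finite Z" "finite X" "\<Union>Z \<subseteq> X" "pairwise disjnt Z" "\<And>p. p \<in> Z \<Longrightarrow> card p = 2"
    and "card X = Suc (card Z + d)"
  shows "\<exists>P :: rat poly. Polynomial.degree P \<le> d \<and> Polynomial.coeff P d = 2 ^ card Z / fact d \<and>
     (\<forall>k\<ge>card Z. of_nat (card (std_monomials X Z k)) = poly P (of_nat k))"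
  using assms
proof (induction Z arbitrary: X rule: finite_induct)
  case empty
  then show ?case
    using binomial_poly[of d] card_monomials_tdeg[of X d] by auto
next
  case (insert p Z)
  obtain a c where p: "p = {a, c}" "a \<noteq> c"
    using insert.prems(4)[of p] by (metis card_2_iff insertI1)
  have ac: "a \<in> X" "c \<in> X" using insert.prems p by auto
  have dj: "q \<inter> p = {}" if "q \<in> Z" for q
    using insert.prems(3) insert.hyps that by (auto simp: pairwise_def disjnt_def)
  \<comment> \<open>Deleting the pair and one of its two variables preserves the relation between
    \<open>card X\<close> and \<open>card Z\<close> with the same \<open>d\<close>; the other
    variable becomes free.\<close>
  have hyp: "\<Union>Z \<subseteq> X - {x}" "card (X - {x}) = Suc (card Z + d)" if "x \<in> {a, c}" for x
    using insert.prems insert.hyps dj p that ac by (auto simp: pairwise_def disjnt_def)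
  have "pairwise disjnt Z" using insert.prems(3) by (simp add: pairwise_def disjnt_def)
  then obtain P1 P2 :: "rat poly" where
    P1: "Polynomial.degree P1 \<le> d" "Polynomial.coeff P1 d = 2 ^ card Z / fact d"
      "\<And>k. k \<ge> card Z \<Longrightarrow> of_nat (card (std_monomials (X - {c}) Z k)) = poly P1 (of_nat k)" and
    P2: "Polynomial.degree P2 \<le> d" "Polynomial.coeff P2 d = 2 ^ card Z / fact d"
      "\<And>k. k \<ge> card Z \<Longrightarrow> of_nat (card (std_monomials (X - {a}) Z k)) = poly P2 (of_nat k)"
    using insert.IH[of "X - {a}"] insert.IH[of "X - {c}"] hyp insert.prems by auto
  define P where "P = P1 + pcompose P2 [:-1, 1:]"
  have "Polynomial.degree P \<le> d"
    unfolding P_def using P1(1) P2(1) by (intro Polynomial.degree_add_le) (auto simp: Polynomial.degree_pcompose)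
  moreover have "Polynomial.coeff P d = 2 ^ card (insert p Z) / fact d"
    unfolding P_def using insert.hyps by (simp add: P1(2) P2(2) coeff_pcompose_shift[OF P2(1)])
  moreover have "of_nat (card (std_monomials X (insert p Z) k)) = poly P (of_nat k)"
    if k: "k \<ge> card (insert p Z)" for k
  proof -
    obtain k' where k': "k = Suc k'" "k' \<ge> card Z"
      using k insert.hyps by (cases k) auto
    have nc: "c \<notin> q" "a \<notin> q" if "q \<in> Z" for q using dj[OF that] p by auto
    have "card (std_monomials X (insert p Z) (Suc k')) =
        card (std_monomials (X - {c}) Z (Suc k')) + card (std_monomials (X - {a}) Z k')"
    proof (rule card_std_monomials_split[OF _ ac(2)])
      fix m
      \<comment> \<open>A factor \<open>c\<close> completes no other pair, since the pairs are
        disjoint; the pair \<open>{a, c}\<close> itself now forbids \<open>a\<close>.\<close>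
      have "q \<subseteq> keys (m + mvar c) \<longleftrightarrow> q \<subseteq> keys m" if "q \<in> Z" for q
        using nc[OF that] by (auto simp: keys_plus_monomial)
      then show "m + mvar c \<in> std_monomials X (insert p Z) (Suc k') \<longleftrightarrow> m \<in> std_monomials (X - {a}) Z k'"
        using p ac by (auto simp: std_monomials_def keys_plus_monomial tdeg_add)
    qed (use insert.prems p in \<open>auto simp: std_monomials_def\<close>)
    then show ?thesis
      using P1(3)[of "Suc k'"] P2(3)[of k'] k' by (simp add: P_def poly_pcompose)
  qed
  ultimately show ?case by blast
qed

section \<open>Rewriting by binomials with coprime leading monomials\<close>

text \<open>As \<open>a\<close> and \<open>b\<close> share no variable, \<open>b\<close> must divide
  \<open>u\<close> and \<open>a\<close> must divide \<open>u'\<close>, with the same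
  cofactor.\<close>

lemma coprime_monomials_common:
  assumes "u + a = u' + b" "keys a \<inter> keys b = {}"
  obtains u'' :: monomial where "u = u'' + b" "u' = u'' + a"
proof
  have eq: "lookup u i + lookup a i = lookup u' i + lookup b i" for i
    using assms(1) by (metis lookup_add)
  have dj: "lookup a i = 0 \<or> lookup b i = 0" for i
    using assms(2) by (auto simp: in_keys_iff)
  have "lookup (u - b + b) i = lookup u i" "lookup (u - b + a) i = lookup u' i" for i
    using eq[of i] dj[of i] by (auto simp: lookup_add lookup_minus)
  then show "u = (u - b) + b" "u' = (u - b) + a"
    by (auto intro!: poly_mapping_eqI)
qed

text \<open>The rule for \<open>C\<close> replaces a factor \<open>z C\<close> by
  \<open>w C\<close>. The hypotheses have separate tasks: \<open>support\<close> and
  \<open>homogeneous\<close> confine the rewriting to a finite set, \<open>no_cycle\<close> makes it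
  terminate, and \<open>coprime\<close> makes it confluent.\<close>

locale coprime_rewriting =
  fixes X :: "nat set" and F :: "'c set" and w z :: "'c \<Rightarrow> monomial"
  assumes finite_X: "finite X"
    and support: "C \<in> F \<Longrightarrow> keys (w C) \<subseteq> X" "C \<in> F \<Longrightarrow> keys (z C) \<subseteq> X"
    and homogeneous: "C \<in> F \<Longrightarrow> tdeg (w C) = tdeg (z C)"
    and coprime: "\<lbrakk>C \<in> F; D \<in> F; C \<noteq> D\<rbrakk> \<Longrightarrow> keys (z C) \<inter> keys (z D) = {}"
    and no_cycle: "\<lbrakk>Cs \<noteq> []; set Cs \<subseteq> F\<rbrakk> \<Longrightarrow> (\<Sum>C\<leftarrow>Cs. w C) \<noteq> (\<Sum>C\<leftarrow>Cs. z C)"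
begin

definition step :: "monomial \<Rightarrow> monomial \<Rightarrow> bool" where
  "step m m' \<longleftrightarrow> (\<exists>C\<in>F. \<exists>u. m = u + z C \<and> m' = u + w C)"

definition normal :: "monomial \<Rightarrow> bool" where
  "normal m \<longleftrightarrow> (\<forall>C\<in>F. \<forall>u. m \<noteq> u + z C)"

lemma step_add: "step m m' \<Longrightarrow> step (u + m) (u + m')"
  unfolding step_def by (metis add.assoc)

lemma equivclp_step_add: "equivclp step m m' \<Longrightarrow> equivclp step (u + m) (u + m')"
proof (induction rule: equivclp_induct)
  case (step y z)
  then show ?case by (meson equivclp_into_equivclp step_add)
qed simp

lemma step_support: "step m m' \<Longrightarrow> keys m \<subseteq> X \<and> tdeg m = k \<Longrightarrow> keys m' \<subseteq> X \<and> tdeg m' = k"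
  unfolding step_def using support homogeneous
  by (elim bexE exE conjE) (fastforce simp: keys_plus_monomial tdeg_add)

text \<open>Each step adds \<open>w C\<close> and removes \<open>z C\<close>, and the intermediate
  monomials telescope. For \<open>m = m'\<close> the monomial cancels and leaves exactly the
  equality that \<open>no_cycle\<close> forbids.\<close>

lemma tranclp_step_balance:
  "step\<^sup>+\<^sup>+ m m' \<Longrightarrow> \<exists>Cs. Cs \<noteq> [] \<and> set Cs \<subseteq> F \<and> m + (\<Sum>C\<leftarrow>Cs. w C) = m' + (\<Sum>C\<leftarrow>Cs. z C)"
proof (induction rule: tranclp_induct)
  case (base y)
  then obtain C u where "C \<in> F" "m = u + z C" "y = u + w C"
    by (auto simp: step_def)
  then show ?case by (intro exI[of _ "[C]"]) (auto simp: ac_simps)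
next
  case (step y y')
  then obtain Cs where Cs: "Cs \<noteq> []" "set Cs \<subseteq> F" "m + (\<Sum>C\<leftarrow>Cs. w C) = y + (\<Sum>C\<leftarrow>Cs. z C)"
    by blast
  obtain C u where C: "C \<in> F" "y = u + z C" "y' = u + w C"
    using step.hyps(2) by (auto simp: step_def)
  have "m + (\<Sum>C\<leftarrow>C # Cs. w C) = w C + (m + (\<Sum>C\<leftarrow>Cs. w C))"
    by (simp add: ac_simps)
  also have "\<dots> = y' + (\<Sum>C\<leftarrow>C # Cs. z C)"
    unfolding Cs(3) C by (simp add: ac_simps)
  finally have "m + (\<Sum>C\<leftarrow>C # Cs. w C) = y' + (\<Sum>C\<leftarrow>C # Cs. z C)" .
  then show ?case using C(1) Cs(2) by (intro exI[of _ "C # Cs"]) auto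
qed

lemma step_irrefl: "\<not> step\<^sup>+\<^sup>+ m m"
  using tranclp_step_balance no_cycle by (metis add_left_imp_eq)

text \<open>Rewriting from \<open>m\<close> stays among the finitely many monomials over
  \<open>X\<close> of the same degree, and an acyclic relation on a finite set admits no infinite
  path.\<close>

lemma normal_form_exists:
  assumes "keys m \<subseteq> X"
  obtains m' where "step\<^sup>*\<^sup>* m m'" "normal m'" "keys m' \<subseteq> X" "tdeg m' = tdeg m"
proof -
  let ?S = "{m'. keys m' \<subseteq> X \<and> tdeg m' = tdeg m}"
  let ?r = "{(a, b). a \<in> ?S \<and> step a b}"
  have "?r \<subseteq> ?S \<times> ?S" using step_support[where k = "tdeg m"] by auto
  then have fin: "finite ?r"
    by (rule finite_subset) (use finite_monomials_tdeg[OF finite_X] in simp)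
  have "(a, b) \<in> ?r\<^sup>+ \<Longrightarrow> step\<^sup>+\<^sup>+ a b" for a b
    by (induction rule: trancl_induct) (auto intro: tranclp.intros)
  then have "acyclic ?r" using step_irrefl by (auto simp: acyclic_def)
  then have wf: "wf (?r\<inverse>)" by (rule finite_acyclic_wf_converse[OF fin])
  have "a \<in> ?S \<longrightarrow> (\<exists>m'\<in>?S. step\<^sup>*\<^sup>* a m' \<and> normal m')" for a
  proof (induction a rule: wf_induct_rule[OF wf])
    case (1 a)
    show ?case
    proof
      assume a: "a \<in> ?S"
      show "\<exists>m'\<in>?S. step\<^sup>*\<^sup>* a m' \<and> normal m'"
      proof (cases "normal a")
        case False
        then obtain b where b: "step a b" by (auto simp: normal_def step_def)
        then have "b \<in> ?S" using a step_support[where k = "tdeg m"] by blast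
        then obtain m' where "m' \<in> ?S" "step\<^sup>*\<^sup>* b m'" "normal m'" using 1[of b] a b by auto
        then show ?thesis using b by (meson converse_rtranclp_into_rtranclp)
      qed (use a in auto)
    qed
  qed
  from this[of m] show ?thesis using assms that by auto
qed

text \<open>If two different rules apply, \<open>z C\<close> and \<open>z D\<close> are coprime and
  their product divides the monomial. The two steps then commute, which is the diamond
  property.\<close>

lemma step_confluent: "confluentp step"
proof (rule strong_confluentp_imp_confluentp, rule strong_confluentpI)
  fix x y y' assume "step x y" "step x y'"
  then obtain C u D u' where C: "C \<in> F" "x = u + z C" "y = u + w C"
    and D: "D \<in> F" "x = u' + z D" "y' = u' + w D"
    unfolding step_def by blast
  show "\<exists>t. step\<^sup>*\<^sup>* y t \<and> step\<^sup>=\<^sup>= y' t"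
  proof (cases "C = D")
    case True
    then show ?thesis using C D by auto
  next
    case False
    then obtain u'' where u'': "u = u'' + z D" "u' = u'' + z C"
      using coprime_monomials_common[of u "z C" u' "z D"] coprime C D by metis
    have "step y (u'' + w C + w D)" "step y' (u'' + w C + w D)"
      unfolding step_def C D u'' using C(1) D(1)
      by (metis add.assoc add.commute)+
    then show ?thesis by auto
  qed
qed

lemma normal_unique:
  assumes "equivclp step m m'" "normal m" "normal m'"
  shows "m = m'"
proof -
  have stuck: "step\<^sup>*\<^sup>* a b \<Longrightarrow> normal a \<Longrightarrow> a = b" for a b
    by (erule converse_rtranclpE) (auto simp: normal_def step_def)
  have "(step\<^sup>*\<^sup>* OO step\<inverse>\<inverse>\<^sup>*\<^sup>*) m m'"
    using semiconfluentp_equivclp[OF confluentp_imp_semiconfluentp[OF step_confluent]] assms(1) by simp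
  then obtain t where "step\<^sup>*\<^sup>* m t" "step\<^sup>*\<^sup>* m' t"
    by (auto simp: rtranclp_conversep)
  then show ?thesis using stuck assms(2,3) by metis
qed

end

section \<open>Membership in binomial ideals\<close>

text \<open>The linear functional with value \<open>\<chi> m\<close> at the monomial
  \<open>m\<close>. With the indicator of a rewriting class as \<open>\<chi>\<close>, it separates
  monomials of different classes modulo the ideal.\<close>

definition weighted_sum :: "(monomial \<Rightarrow> 'k::field) \<Rightarrow> 'k mpoly \<Rightarrow> 'k" where
  "weighted_sum \<chi> p = (\<Sum>m\<in>keys p. \<chi> m * lookup p m)"

lemma weighted_sum_add: "weighted_sum \<chi> (p + q) = weighted_sum \<chi> p + weighted_sum \<chi> q"
  unfolding weighted_sum_def
  by (rule setsum_keys_plus_distrib[where f = "\<lambda>m c. \<chi> m * c"]) (auto simp: distrib_left)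

lemma weighted_sum_zero [simp]: "weighted_sum \<chi> 0 = 0"
  by (simp add: weighted_sum_def)

lemma weighted_sum_sum: "weighted_sum \<chi> (sum f A) = (\<Sum>i\<in>A. weighted_sum \<chi> (f i))"
  by (induction A rule: infinite_finite_induct) (auto simp: weighted_sum_add)

lemma weighted_sum_single [simp]: "weighted_sum \<chi> (Poly_Mapping.single m c) = \<chi> m * c"
  by (simp add: weighted_sum_def)

lemma weighted_sum_uminus [simp]: "weighted_sum \<chi> (- p) = - weighted_sum \<chi> p"
  by (simp add: weighted_sum_def sum_negf)

lemma weighted_sum_mult:
  "weighted_sum \<chi> (p * q) = (\<Sum>a\<in>keys p. lookup p a * weighted_sum (\<lambda>m. \<chi> (a + m)) q)"
proof -
  have "p * q = (\<Sum>a\<in>keys p. \<Sum>b\<in>keys q. Poly_Mapping.single a (lookup p a) * Poly_Mapping.single b (lookup q b))"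
    unfolding sum_product[symmetric]
    by (simp only: mpoly_expand_keys[symmetric])
  then have "weighted_sum \<chi> (p * q) =
      (\<Sum>a\<in>keys p. \<Sum>b\<in>keys q. \<chi> (a + b) * (lookup p a * lookup q b))"
    by (simp only: weighted_sum_sum mult_single weighted_sum_single)
  then show ?thesis
    by (simp add: weighted_sum_def sum_distrib_left ac_simps)
qed

text \<open>
  Quantifying over all invariant weights \<open>\<chi>\<close> is what makes the vanishing stable under multiplication
  by \<open>x\<^sup>u\<close>, which replaces \<open>\<chi>\<close> by its translate by \<open>u\<close>.
\<close>

lemma genideal_weighted_sum_zero:
  fixes B :: "'k::field mpoly set" and r :: "monomial \<Rightarrow> monomial \<Rightarrow> bool"
  assumes B: "\<And>f. f \<in> B \<Longrightarrow> f \<in> carrier (mpoly_ring N) \<and> (\<exists>a b. f = monom_of a - monom_of b \<and> r a b)"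
    and r: "\<And>a b u. r a b \<Longrightarrow> r (u + a) (u + b)"
    and p: "p \<in> genideal (mpoly_ring N) B"
    and \<chi>: "\<And>a b. r a b \<Longrightarrow> \<chi> a = \<chi> b"
  shows "weighted_sum \<chi> p = 0"
proof -
  interpret cring "mpoly_ring N :: 'k mpoly ring" by (rule mpoly_ring_cring)
  let ?J = "{p \<in> carrier (mpoly_ring N). \<forall>\<chi>. (\<forall>a b. r a b \<longrightarrow> \<chi> a = \<chi> b) \<longrightarrow> weighted_sum \<chi> p = (0 :: 'k)}"
  have "ideal ?J (mpoly_ring N)"
  proof (rule mpoly_idealI)
    fix x p :: "'k mpoly" assume x: "x \<in> carrier (mpoly_ring N)" and p: "p \<in> ?J"
    have "weighted_sum \<chi> (x * p) = 0" if \<chi>: "\<forall>a b. r a b \<longrightarrow> \<chi> a = \<chi> b" for \<chi> :: "monomial \<Rightarrow> 'k"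
    proof -
      have "weighted_sum (\<lambda>m. \<chi> (a + m)) p = 0" for a
        using p \<chi> r by auto
      then show ?thesis by (simp add: weighted_sum_mult)
    qed
    then show "x * p \<in> ?J" using x p by (auto intro: mpoly_mult_closed)
  qed (auto simp: weighted_sum_add mpoly_add_closed)
  moreover have "B \<subseteq> ?J"
  proof
    fix f assume "f \<in> B"
    then obtain a b where "f \<in> carrier (mpoly_ring N)" "f = monom_of a + - monom_of b" "r a b"
      using B by (metis diff_conv_add_uminus)
    then show "f \<in> ?J" by (simp add: weighted_sum_add del: add_uminus_conv_diff)
  qed
  ultimately have "genideal (mpoly_ring N) B \<subseteq> ?J"
    by (rule genideal_minimal)
  then show ?thesis using p \<chi> by auto
qed

section \<open>Four-cycles and the Hilbert function\<close>

text \<open>A monomial of degree two is determined by its support, a singleton meaning a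
  square.\<close>

lemma mvar_add_eq_iff: "mvar a + mvar b = mvar c + mvar d \<longleftrightarrow> {a, b} = {c, d}"
proof
  assume "mvar a + mvar b = mvar c + mvar d"
  then have "keys (mvar a + mvar b) = keys (mvar c + mvar d)" by simp
  then show "{a, b} = {c, d}" by (simp add: keys_plus_monomial insert_commute)
qed (auto simp: doubleton_eq_iff add.commute)

lemma consecutive_disjoint:
  assumes "consecutive_in_4cycle N e a b c d"
  shows "e a \<inter> e c = {}" "e b \<inter> e d = {}" "e a \<inter> e b \<noteq> {}" "e b \<inter> e c \<noteq> {}"
    "e c \<inter> e d \<noteq> {}" "e a \<inter> e d \<noteq> {}" "distinct [a, b, c, d]"
proof -
  obtain p q r s where h: "distinct [p, q, r, s]"
    "e a = {p, q}" "e b = {q, r}" "e c = {r, s}" "e d = {s, p}"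
    using assms by (auto simp: consecutive_in_4cycle_def)
  show "e a \<inter> e c = {}" "e b \<inter> e d = {}" "e a \<inter> e b \<noteq> {}" "e b \<inter> e c \<noteq> {}"
    "e c \<inter> e d \<noteq> {}" "e a \<inter> e d \<noteq> {}"
    using h by auto
  have "e a \<noteq> e b" "e a \<noteq> e c" "e a \<noteq> e d" "e b \<noteq> e c" "e b \<noteq> e d" "e c \<noteq> e d"
    using h by (auto simp: doubleton_eq_iff)
  then show "distinct [a, b, c, d]" by auto
qed

text \<open>Opposite edges are the disjoint ones, so the edge set alone determines the two opposite
  pairs, and with them the binomial up to sign. This is why a four-cycle may be given as a set
  although the choice of \<open>z\<close> refers to a cyclic listing.\<close>

lemma four_cycle_opposite_unique:
  assumes "consecutive_in_4cycle N e a b c d" "consecutive_in_4cycle N e a' b' c' d'"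
    and "{a, b, c, d} = {a', b', c', d'}"
  shows "({a', c'} = {a, c} \<and> {b', d'} = {b, d}) \<or> ({a', c'} = {b, d} \<and> {b', d'} = {a, c})"
proof -
  note h = consecutive_disjoint[OF assms(1)] consecutive_disjoint[OF assms(2)]
  have opp: "{x, y} = {a, c} \<or> {x, y} = {b, d}"
    if "x \<in> {a, b, c, d}" "y \<in> {a, b, c, d}" "e x \<inter> e y = {}" "x \<noteq> y" for x y
    using that h(1-6) by (elim insertE emptyE) (simp_all add: Int_commute insert_commute)
  have "{a', c'} = {a, c} \<or> {a', c'} = {b, d}" "{b', d'} = {a, c} \<or> {b', d'} = {b, d}"
    using opp[of a' c'] opp[of b' d'] h(7-14) unfolding assms(3) by simp_all
  moreover have "{a', c'} \<noteq> {b', d'}" using h(14) by (auto simp: doubleton_eq_iff)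
  ultimately show ?thesis by auto
qed

lemma finite_four_cycles: "finite (four_cycles N e)"
proof (rule finite_subset)
  show "four_cycles N e \<subseteq> Pow {1..N}"
    by (auto simp: four_cycles_def consecutive_in_4cycle_def)
qed simp

lemma toric_exp_edge:
  assumes "e i = {p, q}" "p \<noteq> q"
  shows "toric_exp e (mvar i) = mvar p + mvar q"
  using assms by (simp add: toric_exp_mvar)

text \<open>Each of the two opposite pairs covers every vertex of the cycle exactly once.\<close>

lemma consecutive_toric_exp_eq:
  assumes "consecutive_in_4cycle N e a b c d"
  shows "toric_exp e (mvar a + mvar c) = toric_exp e (mvar b + mvar d)"
proof -
  obtain p q r s where h: "distinct [p, q, r, s]"
    "e a = {p, q}" "e b = {q, r}" "e c = {r, s}" "e d = {s, p}"
    using assms by (auto simp: consecutive_in_4cycle_def)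
  then have "toric_exp e (mvar a) = mvar p + mvar q" "toric_exp e (mvar b) = mvar q + mvar r"
    "toric_exp e (mvar c) = mvar r + mvar s" "toric_exp e (mvar d) = mvar s + mvar p"
    by (auto intro: toric_exp_edge)
  then show ?thesis by (simp add: toric_exp_add ac_simps)
qed

lemma toric_ideal_def': "toric_ideal v N e = {p \<in> carrier (mpoly_ring N). toric_hom e p = 0}"
  by (simp add: toric_ideal_def a_kernel_def')

lemma monom_of_inject: "monom_of a = (monom_of b :: 'k::field mpoly) \<longleftrightarrow> a = b"
proof
  assume "monom_of a = (monom_of b :: 'k mpoly)"
  then have "keys (monom_of a :: 'k mpoly) = keys (monom_of b :: 'k mpoly)" by simp
  then show "a = b" by simp
qed simp

text \<open>Here \<open>k\<close> counts edges; in a graph the resulting vertex exponents have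
  degree \<open>2 * k\<close>.\<close>

definition toric_exps :: "nat \<Rightarrow> (nat \<Rightarrow> nat set) \<Rightarrow> nat \<Rightarrow> monomial set" where
  "toric_exps N e k = toric_exp e ` {m. keys m \<subseteq> {1..N} \<and> tdeg m = k}"

lemma finite_toric_exps: "finite (toric_exps N e k)"
  unfolding toric_exps_def by (intro finite_imageI finite_monomials_tdeg) simp

section \<open>Quadratic relations of a bipartite graph, and its exponents as normal forms\<close>

context connected_bipartite_graph
begin

lemma bipartition:
  "\<exists>A B. A \<inter> B = {} \<and> A \<union> B = {1..v} \<and> (\<forall>i\<in>{1..N}. \<exists>p\<in>A. \<exists>q\<in>B. e i = {p, q})"
proof -
  obtain A B where AB: "A \<union> B = {1..v}" "A \<inter> B = {}"
    "\<And>i. i \<in> {1..N} \<Longrightarrow> card (e i \<inter> A) = 1 \<and> card (e i \<inter> B) = 1"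
    using bipartite by blast
  have "\<exists>p\<in>A. \<exists>q\<in>B. e i = {p, q}" if i: "i \<in> {1..N}" for i
  proof -
    obtain p q where pq: "e i \<inter> A = {p}" "e i \<inter> B = {q}"
      using AB(3)[OF i] by (auto simp: card_1_singleton_iff)
    have "e i = (e i \<inter> A) \<union> (e i \<inter> B)" using edge[OF i] AB(1) by auto
    then have "e i = {p, q}" using pq by auto
    then show ?thesis using pq by blast
  qed
  then show ?thesis using AB(1,2) by blast
qed

text \<open>Comparing exponents on each side of the bipartition, the \<open>A\<close>-ends of
  \<open>a, b\<close> agree with those of \<open>c, d\<close> as multisets, and so do the
  \<open>B\<close>-ends. If both were matched in the same order, the edges would coincide, since the
  graph is simple, and the two monomials would be equal. So the matchings are crossed, and following
  them gives the cyclic order \<open>a, c, b, d\<close>.\<close>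

lemma quadratic_relation_is_four_cycle:
  assumes idx: "{a, b, c, d} \<subseteq> {1..N}"
    and eq: "toric_exp e (mvar a + mvar b) = toric_exp e (mvar c + mvar d)"
    and ne: "mvar a + mvar b \<noteq> mvar c + mvar d"
  shows "consecutive_in_4cycle N e a c b d"
proof -
  obtain A B where dj: "A \<inter> B = {}" and "A \<union> B = {1..v}" and
    ed: "\<forall>i\<in>{1..N}. \<exists>p\<in>A. \<exists>q\<in>B. e i = {p, q}"
    using bipartition by (elim exE conjE)
  have "\<forall>i\<in>{1..N}. \<exists>pq. fst pq \<in> A \<and> snd pq \<in> B \<and> e i = {fst pq, snd pq}"
    using ed by fastforce
  from bchoice[OF this] obtain pq
    where h: "\<forall>i\<in>{1..N}. fst (pq i) \<in> A \<and> snd (pq i) \<in> B \<and> e i = {fst (pq i), snd (pq i)}" ..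
  define p where "p = (\<lambda>i. fst (pq i))"
  define q where "q = (\<lambda>i. snd (pq i))"
  have pA: "p i \<in> A" and qB: "q i \<in> B" and pq: "e i = {p i, q i}" if "i \<in> {1..N}" for i
    unfolding p_def q_def using bspec[OF h that] by simp_all
  have idx': "a \<in> {1..N}" "b \<in> {1..N}" "c \<in> {1..N}" "d \<in> {1..N}" using idx by simp_all
  have inj: "i = j" if "p i = p j" "q i = q j" "i \<in> {1..N}" "j \<in> {1..N}" for i j
  proof (rule inj_onD[OF edges_distinct _ that(3,4)])
    show "e i = e j"
      unfolding pq[OF that(3)] pq[OF that(4)] using that(1,2) by simp
  qed
  have pne: "p i \<noteq> q j" if "i \<in> {1..N}" "j \<in> {1..N}" for i j
    using pA[OF that(1)] qB[OF that(2)] dj by auto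
  have te: "toric_exp e (mvar i) = mvar (p i) + mvar (q i)" if "i \<in> {1..N}" for i
    using pq[OF that] pne[OF that that] by (rule toric_exp_edge)
  have "toric_exp e (mvar a + mvar b) = (mvar (p a) + mvar (p b)) + (mvar (q a) + mvar (q b))"
    "toric_exp e (mvar c + mvar d) = (mvar (p c) + mvar (p d)) + (mvar (q c) + mvar (q d))"
    by (simp_all add: toric_exp_add te[OF idx'(1)] te[OF idx'(2)] te[OF idx'(3)] te[OF idx'(4)] ac_simps)
  then have sum: "(mvar (p a) + mvar (p b)) + (mvar (q a) + mvar (q b)) =
      (mvar (p c) + mvar (p d)) + (mvar (q c) + mvar (q d))"
    using eq by metis
  have "mvar (p a) + mvar (p b) = mvar (p c) + mvar (p d)"
  proof (rule poly_mapping_eqI)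
    fix x
    have l: "lookup (mvar (p a) + mvar (p b)) x + lookup (mvar (q a) + mvar (q b)) x =
        lookup (mvar (p c) + mvar (p d)) x + lookup (mvar (q c) + mvar (q d)) x"
      by (metis sum lookup_add)
    show "lookup (mvar (p a) + mvar (p b)) x = lookup (mvar (p c) + mvar (p d)) x"
    proof (cases "x \<in> A")
      case True
      then have "q a \<noteq> x" "q b \<noteq> x" "q c \<noteq> x" "q d \<noteq> x"
        using qB[OF idx'(1)] qB[OF idx'(2)] qB[OF idx'(3)] qB[OF idx'(4)] dj by auto
      then show ?thesis using l by (simp add: lookup_add lookup_mvar)
    next
      case False
      then have "p a \<noteq> x" "p b \<noteq> x" "p c \<noteq> x" "p d \<noteq> x"
        using pA[OF idx'(1)] pA[OF idx'(2)] pA[OF idx'(3)] pA[OF idx'(4)] by auto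
      then show ?thesis by (simp add: lookup_add lookup_mvar)
    qed
  qed
  with sum have P: "{p a, p b} = {p c, p d}" and Q: "{q a, q b} = {q c, q d}"
    by (simp_all add: mvar_add_eq_iff)
  have P': "(p a = p c \<and> p b = p d) \<or> (p a = p d \<and> p b = p c)"
    and Q': "(q a = q c \<and> q b = q d) \<or> (q a = q d \<and> q b = q c)"
    using P Q by (simp_all only: doubleton_eq_iff)
  have inj': "p a = p c \<and> q a = q c \<longrightarrow> a = c" "p a = p d \<and> q a = q d \<longrightarrow> a = d"
    "p b = p c \<and> q b = q c \<longrightarrow> b = c" "p b = p d \<and> q b = q d \<longrightarrow> b = d"
    using inj idx' by simp_all
  have ne': "\<not> (a = c \<and> b = d)" "\<not> (a = d \<and> b = c)"
    using ne by (auto simp: add.commute)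
  have cases: "(p a = p c \<and> p b = p d \<and> q a = q d \<and> q b = q c) \<or> (p a = p d \<and> p b = p c \<and> q a = q c \<and> q b = q d)"
    using P' Q' ne' inj' by satx
  \<comment> \<open>\<open>satx\<close> treats equations as atoms, hence these instances of
    substitution. If the \<open>A\<close>-ends of \<open>a\<close> and \<open>b\<close> coincide,
    all four \<open>A\<close>-ends do, and the matching of the \<open>B\<close>-ends alone
    identifies the edges in pairs, contrary to \<open>ne'\<close>.\<close>
  have "p a = p b \<longrightarrow> (p a = p d \<longleftrightarrow> p b = p d) \<and> (p a = p c \<longleftrightarrow> p b = p c)"
    "q a = q b \<longrightarrow> (q a = q d \<longleftrightarrow> q b = q d) \<and> (q a = q c \<longleftrightarrow> q b = q c)"
    by simp_all
  with cases ne' inj' have ne1: "\<not> p a = p b" and ne2: "\<not> q a = q b" by satx+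
  have ne3: "p a \<noteq> q a" "p a \<noteq> q b" "p b \<noteq> q a" "p b \<noteq> q b"
    using pne idx' by simp_all
  have cyc: "consecutive_in_4cycle N e a c b d"
    if "distinct [x, y, r, s]" "e a = {x, y}" "e c = {y, r}" "e b = {r, s}" "e d = {s, x}" for x y r s
    unfolding consecutive_in_4cycle_def using idx
    by (intro conjI exI[of _ x] exI[of _ y] exI[of _ r] exI[of _ s] that) auto
  from cases show ?thesis
  proof (elim disjE conjE)
    assume eqs: "p a = p c" "p b = p d" "q a = q d" "q b = q c"
    show ?thesis
    proof (rule cyc)
      show "distinct [q a, p a, q b, p b]" using ne1 ne2 ne3 by auto
    qed (simp_all only: pq[OF idx'(1)] pq[OF idx'(2)] pq[OF idx'(3)] pq[OF idx'(4)] eqs insert_commute)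
  next
    assume eqs: "p a = p d" "p b = p c" "q a = q c" "q b = q d"
    show ?thesis
    proof (rule cyc)
      show "distinct [p a, q a, p b, q b]" using ne1 ne2 ne3 by auto
    qed (simp_all only: pq[OF idx'(1)] pq[OF idx'(2)] pq[OF idx'(3)] pq[OF idx'(4)] eqs insert_commute)
  qed
qed


text \<open>Passes from the graph to pure counting: \<open>Z\<close> collects the supports of the
  chosen \<open>z C\<close>, the normal forms are the standard monomials, and
  \<open>toric_exp\<close> maps those of degree \<open>k\<close> bijectively to the
  exponents.\<close>

theorem card_toric_exps:
  assumes gen: "generated_by_quadratic_binomials N (toric_ideal v N e :: 'k::field mpoly set)"
    and good: "good_graph N e"
  obtains Z where "finite Z" "card Z = card (four_cycles N e)" "\<Union>Z \<subseteq> {1..N}" "pairwise disjnt Z"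
    "\<And>p. p \<in> Z \<Longrightarrow> card p = 2"
    "\<And>k. card (toric_exps N e k) = card (std_monomials {1..N} Z k)"
proof -
  let ?F = "four_cycles N e"
  obtain w z :: "nat set \<Rightarrow> monomial" where
    wz': "\<forall>C\<in>?F. \<exists>a b c d. consecutive_in_4cycle N e a b c d \<and> C = {a, b, c, d} \<and>
         z C = mvar a + mvar c \<and> w C = mvar b + mvar d"
    and coprime: "\<forall>C\<in>?F. \<forall>D\<in>?F. C \<noteq> D \<longrightarrow> keys (z C) \<inter> keys (z D) = {}"
    and no_cycle: "\<forall>Cs. Cs \<noteq> [] \<and> set Cs \<subseteq> ?F \<longrightarrow> (\<Sum>C\<leftarrow>Cs. w C) \<noteq> (\<Sum>C\<leftarrow>Cs. z C)"
    using good unfolding good_graph_def by (elim exE conjE)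
  note wz = bspec[OF wz']
  interpret coprime_rewriting "{1..N}" ?F w z
  proof
    fix C assume "C \<in> ?F"
    then obtain a b c d where "consecutive_in_4cycle N e a b c d"
      "z C = mvar a + mvar c" "w C = mvar b + mvar d" using wz by blast
    then show "keys (w C) \<subseteq> {1..N}" "keys (z C) \<subseteq> {1..N}" "tdeg (w C) = tdeg (z C)"
      by (auto simp: consecutive_in_4cycle_def keys_plus_monomial tdeg_add)
  next
    show "keys (z C) \<inter> keys (z D) = {}" if "C \<in> ?F" "D \<in> ?F" "C \<noteq> D" for C D
      using coprime that by simp
    show "(\<Sum>C\<leftarrow>Cs. w C) \<noteq> (\<Sum>C\<leftarrow>Cs. z C)" if "Cs \<noteq> []" "set Cs \<subseteq> ?F" for Cs
      using no_cycle that by simp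
  qed simp
  have toric_step: "toric_exp e m = toric_exp e m'" if step: "step m m'" for m m'
  proof -
    obtain C u where C: "C \<in> ?F" "m = u + z C" "m' = u + w C"
      using step by (auto simp: step_def)
    obtain a b c d where "consecutive_in_4cycle N e a b c d"
      "z C = mvar a + mvar c" "w C = mvar b + mvar d" using wz C(1) by blast
    then have "toric_exp e (z C) = toric_exp e (w C)"
      using consecutive_toric_exp_eq by metis
    then show ?thesis by (simp add: C toric_exp_add)
  qed
  have toric_steps: "toric_exp e m = toric_exp e m'" if "step\<^sup>*\<^sup>* m m'" for m m'
    using that by (induction rule: rtranclp_induct) (auto dest: toric_step)
  obtain B :: "'k mpoly set" where B: "\<And>f. f \<in> B \<Longrightarrow> quadratic_binomial N f"
    and I: "toric_ideal v N e = genideal (mpoly_ring N) B"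
    using gen unfolding generated_by_quadratic_binomials_def by blast
  interpret R: cring "mpoly_ring N :: 'k mpoly ring" by (rule mpoly_ring_cring)
  have B_monom: "\<exists>a\<in>{1..N}. \<exists>b\<in>{1..N}. \<exists>c\<in>{1..N}. \<exists>d\<in>{1..N}.
      f = monom_of (mvar a + mvar b) - monom_of (mvar c + mvar d) \<and> f \<noteq> 0"
    if "f \<in> B" for f
    using B[OF that] by (simp add: quadratic_binomial_def Var_def mult_single)
  have B_carrier: "B \<subseteq> carrier (mpoly_ring N)"
  proof
    fix f assume "f \<in> B"
    then obtain a b c d where "{a, b, c, d} \<subseteq> {1..N}"
      "f = monom_of (mvar a + mvar b) - monom_of (mvar c + mvar d)"
      using B_monom by blast
    then show "f \<in> carrier (mpoly_ring N)"
      by (auto intro!: mpoly_diff_closed simp: keys_plus_monomial)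
  qed
  \<comment> \<open>The generating set \<open>B\<close> is arbitrary, but a nonzero quadratic
    binomial in the ideal is a four-cycle relation, hence up to sign some \<open>w C - z C\<close>:
    a single rewriting step, read in one direction or the other.\<close>
  have B_equiv: "\<exists>a b. f = monom_of a - monom_of b \<and> equivclp step a b" if f: "f \<in> B" for f
  proof -
    obtain a b c d where f: "f = monom_of (mvar a + mvar b) - monom_of (mvar c + mvar d)" "f \<noteq> 0"
      and idx: "{a, b, c, d} \<subseteq> {1..N}"
      using B_monom[OF f] by blast
    have "f \<in> toric_ideal v N e"
      using R.genideal_self[OF B_carrier] that I by blast
    then have eq: "toric_exp e (mvar a + mvar b) = toric_exp e (mvar c + mvar d)"
      using f by (simp add: toric_ideal_def' toric_hom_diff toric_hom_single monom_of_inject)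
    have cyc: "consecutive_in_4cycle N e a c b d"
      using f idx eq by (intro quadratic_relation_is_four_cycle) auto
    then have C: "{a, c, b, d} \<in> ?F" by (auto simp: four_cycles_def)
    obtain a' b' c' d' where abcd': "consecutive_in_4cycle N e a' b' c' d'"
      "{a, c, b, d} = {a', b', c', d'}"
      "z {a, c, b, d} = mvar a' + mvar c'" "w {a, c, b, d} = mvar b' + mvar d'"
      using wz[OF C] by blast
    have st: "step (z {a, c, b, d}) (w {a, c, b, d})"
      unfolding step_def using C by (intro bexI[of _ "{a, c, b, d}"] exI[of _ 0]) auto
    have "{mvar a' + mvar c', mvar b' + mvar d'} = {mvar a + mvar b, mvar c + mvar d}"
      using four_cycle_opposite_unique[OF cyc abcd'(1,2)]
      by (elim disjE conjE) (simp_all flip: mvar_add_eq_iff add: insert_commute)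
    then have "step (mvar a + mvar b) (mvar c + mvar d) \<or> step (mvar c + mvar d) (mvar a + mvar b)"
      using st abcd'(3,4) by (auto simp: doubleton_eq_iff)
    then have "equivclp step (mvar a + mvar b) (mvar c + mvar d)"
      by (meson equivclp_sym r_into_equivclp)
    then show ?thesis using f by blast
  qed
  have connected: "equivclp step m m'"
    if m: "keys m \<subseteq> {1..N}" "keys m' \<subseteq> {1..N}" "toric_exp e m = toric_exp e m'" for m m'
  proof -
    let ?p = "monom_of m - monom_of m' :: 'k mpoly"
    \<comment> \<open>The indicator of the rewriting class of \<open>m\<close> is constant on
      classes, so its functional vanishes on the ideal. On \<open>m - m'\<close> it is
      \<open>1\<close> minus the indicator at \<open>m'\<close>, which puts \<open>m'\<close> into
      the class of \<open>m\<close>.\<close>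
    let ?\<chi> = "\<lambda>x. of_bool (equivclp step m x) :: 'k"
    have "?p \<in> toric_ideal v N e"
      using m by (auto simp: toric_ideal_def' toric_hom_diff toric_hom_single intro: mpoly_diff_closed)
    then have "weighted_sum ?\<chi> ?p = 0"
      unfolding I
    proof (rule genideal_weighted_sum_zero[where r = "equivclp step", rotated 2])
      show "?\<chi> a = ?\<chi> b" if "equivclp step a b" for a b
      proof -
        have "equivclp step m a \<longleftrightarrow> equivclp step m b"
          using that by (meson equivclp_sym equivclp_trans)
        then show ?thesis by simp
      qed
      show "f \<in> carrier (mpoly_ring N) \<and> (\<exists>a b. f = monom_of a - monom_of b \<and> equivclp step a b)"
        if "f \<in> B" for f
        using B_carrier B_equiv[OF that] that by (intro conjI subsetD[OF B_carrier])
    qed (rule equivclp_step_add)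
    moreover have "weighted_sum ?\<chi> ?p = ?\<chi> m - ?\<chi> m'"
      using weighted_sum_add[of ?\<chi> "monom_of m" "- monom_of m'"] by simp
    ultimately have "?\<chi> m' = 1" by simp
    then show ?thesis by (cases "equivclp step m m'") simp_all
  qed
  define Z where "Z = (\<lambda>C. keys (z C)) ` ?F"
  have two: "\<exists>a c. z C = mvar a + mvar c \<and> keys (z C) = {a, c} \<and> a \<noteq> c \<and> {a, c} \<subseteq> {1..N}" if C: "C \<in> ?F" for C
  proof -
    obtain a b c d where abcd: "consecutive_in_4cycle N e a b c d" "z C = mvar a + mvar c"
      using wz[OF C] by blast
    then have "keys (z C) = {a, c}" "a \<noteq> c" "{a, c} \<subseteq> {1..N}"
      using consecutive_disjoint(7)[OF abcd(1)]
      by (simp_all add: keys_plus_monomial consecutive_in_4cycle_def insert_commute)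
    then show ?thesis using abcd(2) by (intro exI conjI)
  qed
  \<comment> \<open>Supports of different \<open>z C\<close> are disjoint and nonempty, hence
    different; so no four-cycle is lost when \<open>Z\<close> is counted.\<close>
  have inj: "inj_on (\<lambda>C. keys (z C)) ?F"
  proof (rule inj_onI, rule ccontr)
    fix C D assume CD: "C \<in> ?F" "D \<in> ?F" "keys (z C) = keys (z D)" "C \<noteq> D"
    then have "keys (z C) = {}" using coprime[of C D] by simp
    then show False using two[of C] CD(1) by auto
  qed
  \<comment> \<open>Each \<open>z C\<close> is square-free because opposite edges are distinct, so
    containment of supports already means divisibility.\<close>
  have normal_iff: "normal m \<longleftrightarrow> (\<forall>p\<in>Z. \<not> p \<subseteq> keys m)" for m
  proof -
    have "(\<exists>u. m = u + z C) \<longleftrightarrow> keys (z C) \<subseteq> keys m" if C: "C \<in> ?F" for C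
    proof
      assume sub: "keys (z C) \<subseteq> keys m"
      obtain a c where ac: "z C = mvar a + mvar c" "keys (z C) = {a, c}" "a \<noteq> c"
        using two[OF C] by blast
      have "m - z C + z C = m"
      proof (rule poly_mapping_eqI)
        fix i
        have "lookup (z C) i \<le> lookup m i"
          using sub ac by (auto simp: lookup_add lookup_mvar in_keys_iff)
        then show "lookup (m - z C + z C) i = lookup m i"
          by (simp add: lookup_add lookup_minus)
      qed
      then show "\<exists>u. m = u + z C" by metis
    qed (auto simp: keys_plus_monomial)
    then have "(\<forall>u. m \<noteq> u + z C) \<longleftrightarrow> \<not> keys (z C) \<subseteq> keys m" if "C \<in> ?F" for C
      using that by blast
    then show ?thesis unfolding normal_def Z_def by blast
  qed
  have "bij_betw (toric_exp e) (std_monomials {1..N} Z k) (toric_exps N e k)" for k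
  proof (rule bij_betwI')
    show "toric_exp e m = toric_exp e m' \<longleftrightarrow> m = m'"
      if "m \<in> std_monomials {1..N} Z k" "m' \<in> std_monomials {1..N} Z k" for m m'
      using that connected[of m m'] normal_unique[of m m'] normal_iff
      by (auto simp: std_monomials_def)
    show "toric_exp e m \<in> toric_exps N e k" if "m \<in> std_monomials {1..N} Z k" for m
      using that by (auto simp: std_monomials_def toric_exps_def)
    show "\<exists>m\<in>std_monomials {1..N} Z k. y = toric_exp e m" if y: "y \<in> toric_exps N e k" for y
    proof -
      obtain m where m: "keys m \<subseteq> {1..N}" "tdeg m = k" "y = toric_exp e m"
        using y by (auto simp: toric_exps_def)
      obtain m' where "step\<^sup>*\<^sup>* m m'" "normal m'" "keys m' \<subseteq> {1..N}" "tdeg m' = tdeg m"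
        using normal_form_exists[OF m(1)] by blast
      then show ?thesis
        using m toric_steps[of m m'] normal_iff by (intro bexI[of _ m']) (auto simp: std_monomials_def)
    qed
  qed
  then have card: "card (toric_exps N e k) = card (std_monomials {1..N} Z k)" for k
    using bij_betw_same_card by metis
  have Z_pair: "card p = 2 \<and> p \<subseteq> {1..N}" if p: "p \<in> Z" for p
  proof -
    obtain C where C: "C \<in> ?F" "p = keys (z C)" using p by (auto simp: Z_def)
    obtain a c where "keys (z C) = {a, c}" "a \<noteq> c" "{a, c} \<subseteq> {1..N}" using two[OF C(1)] by blast
    then show ?thesis by (simp add: C(2))
  qed
  show ?thesis
  proof (rule that)
    show "finite Z" "card Z = card ?F"
      unfolding Z_def by (simp_all add: finite_four_cycles card_image[OF inj])
    show "\<Union>Z \<subseteq> {1..N}" using Z_pair by (intro Union_least) simp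
    show "pairwise disjnt Z"
    proof (rule pairwiseI)
      fix p q assume "p \<in> Z" "q \<in> Z" "p \<noteq> q"
      then obtain C D where "C \<in> ?F" "D \<in> ?F" "p = keys (z C)" "q = keys (z D)" "C \<noteq> D"
        by (auto simp: Z_def)
      then show "disjnt p q" using coprime[of C D] by (simp add: disjnt_def)
    qed
    show "card p = 2" if "p \<in> Z" for p
      using Z_pair[OF that] by simp
  qed (rule card)
qed

end

section \<open>The toric ring and the powers of its maximal ideal at the origin\<close>

lemma (in ring_hom_ring) ideal_image_surj:
  assumes I: "ideal I R" and surj: "h ` carrier R = carrier S"
  shows "ideal (h ` I) S"
proof (rule idealI)
  interpret I: ideal I R by (rule I)
  show "subgroup (h ` I) (add_monoid S)"
  proof (rule S.add.subgroupI)
    show "h ` I \<subseteq> carrier S" using I.Icarr by auto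
    show "h ` I \<noteq> {}" using additive_subgroup.zero_closed[OF I.is_additive_subgroup] by blast
  next
    fix a assume "a \<in> h ` I"
    then obtain x where x: "a = h x" "x \<in> I" by blast
    have "\<ominus>\<^bsub>S\<^esub> a = h (\<ominus>\<^bsub>R\<^esub> x)" using x I.Icarr by simp
    then show "\<ominus>\<^bsub>S\<^esub> a \<in> h ` I"
      using additive_subgroup.a_inv_closed[OF I.is_additive_subgroup x(2)] by blast
  next
    fix a b assume "a \<in> h ` I" "b \<in> h ` I"
    then obtain x y where xy: "a = h x" "x \<in> I" "b = h y" "y \<in> I" by blast
    then have "a \<oplus>\<^bsub>S\<^esub> b = h (x \<oplus>\<^bsub>R\<^esub> y)" using I.Icarr by simp
    then show "a \<oplus>\<^bsub>S\<^esub> b \<in> h ` I"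
      using additive_subgroup.a_closed[OF I.is_additive_subgroup xy(2,4)] by blast
  qed
  fix a x assume "a \<in> h ` I" "x \<in> carrier S"
  then obtain i y where iy: "a = h i" "i \<in> I" "x = h y" "y \<in> carrier R" using surj by blast
  have "x \<otimes>\<^bsub>S\<^esub> a = h (y \<otimes>\<^bsub>R\<^esub> i)" "a \<otimes>\<^bsub>S\<^esub> x = h (i \<otimes>\<^bsub>R\<^esub> y)" using iy I.Icarr by simp_all
  then show "x \<otimes>\<^bsub>S\<^esub> a \<in> h ` I" "a \<otimes>\<^bsub>S\<^esub> x \<in> h ` I"
    using I.I_l_closed[OF iy(2,4)] I.I_r_closed[OF iy(2,4)] by blast+
qed (rule S.ring_axioms)

text \<open>The \<open>k\<close>-th power of the ideal of the origin in the polynomial ring,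
  described by the degrees of the terms; for \<open>k = 0\<close> it is the whole ring.\<close>

definition order_ge :: "nat \<Rightarrow> nat \<Rightarrow> 'k::field mpoly set" where
  "order_ge N k = {f \<in> carrier (mpoly_ring N). \<forall>m\<in>keys f. k \<le> tdeg m}"

lemma order_ge_carrier: "f \<in> order_ge N k \<Longrightarrow> f \<in> carrier (mpoly_ring N)"
  by (simp add: order_ge_def)

lemma order_ge_add: "f \<in> order_ge N k \<Longrightarrow> g \<in> order_ge N k \<Longrightarrow> f + g \<in> order_ge N k"
  using keys_add[of f g] by (auto simp: order_ge_def intro: mpoly_add_closed)

lemma order_ge_mult: "f \<in> order_ge N k \<Longrightarrow> g \<in> order_ge N l \<Longrightarrow> f * g \<in> order_ge N (k + l)"
  using keys_mult[of f g]
  by (fastforce simp: order_ge_def tdeg_add intro: mpoly_mult_closed add_mono)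

lemma order_ge_0: "order_ge N 0 = carrier (mpoly_ring N)"
  by (simp add: order_ge_def)

lemma order_ge_single: "keys m \<subseteq> {1..N} \<Longrightarrow> k \<le> tdeg m \<Longrightarrow> Poly_Mapping.single m c \<in> order_ge N k"
  by (auto simp: order_ge_def)

lemma Const_subfield: "subfield (range Const) (mpoly_ring N :: 'k::field mpoly ring)"
proof -
  interpret domain "mpoly_ring N :: 'k mpoly ring" by (rule mpoly_ring_domain)
  have uminus: "- Const c = Const (- c)" for c :: 'k
    by (simp add: Const_def single_uminus)
  have sub: "subring (range Const) (mpoly_ring N :: 'k mpoly ring)"
  proof (rule subringI)
    show "\<ominus>\<^bsub>mpoly_ring N\<^esub> h \<in> range Const" if "h \<in> range Const" for h :: "'k mpoly"
      using that by (auto simp: mpoly_ring_a_inv uminus)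
    show "\<one>\<^bsub>mpoly_ring N\<^esub> \<in> (range Const :: 'k mpoly set)"
      by (metis Const_one mpoly_ring_simps(2) rangeI)
  qed (auto simp flip: Const_add Const_mult)
  show ?thesis
  proof (rule subfieldI)
    show "subcring (range Const) (mpoly_ring N :: 'k mpoly ring)"
      by (rule subcringI[OF sub]) (auto simp: mult.commute)
    have "Const c \<noteq> 0 \<longleftrightarrow> c \<noteq> 0" for c :: 'k
      by (metis Const_zero Const_def lookup_single_eq lookup_zero)
    moreover have "Const c * Const (inverse c) = 1" if "c \<noteq> 0" for c :: 'k
      using that by (simp flip: Const_mult)
    ultimately show "Units ((mpoly_ring N :: 'k mpoly ring)\<lparr>carrier := range Const\<rparr>) = range Const - {\<zero>\<^bsub>mpoly_ring N\<^esub>}"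
      by (force simp: Units_def mult.commute)
  qed
qed

section \<open>Classes in the toric ring, order at the origin, and the graded pieces\<close>

context connected_bipartite_graph
begin

lemma edge_pair:
  assumes "i \<in> {1..N}"
  obtains p q where "e i = {p, q}" "p \<noteq> q" "p \<in> {1..v}" "q \<in> {1..v}"
proof -
  obtain p q where "e i = {p, q}" "p \<noteq> q"
    using edge[OF assms] by (auto simp: card_2_iff)
  moreover have "p \<in> {1..v}" "q \<in> {1..v}"
    using edge[OF assms] calculation(1) by auto
  ultimately show ?thesis by (rule that)
qed

lemma keys_toric_exp:
  assumes "keys m \<subseteq> {1..N}"
  shows "keys (toric_exp e m) = (\<Union>i\<in>keys m. e i)"
proof -
  have fin: "finite (e i)" if "i \<in> keys m" for i
  proof -
    have "card (e i) = 2" using edge assms that by blast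
    then show ?thesis by (metis card.infinite zero_neq_numeral)
  qed
  have "keys (toric_exp e m) = (\<Union>i\<in>keys m. \<Union>a\<in>e i. keys (Poly_Mapping.single a (lookup m i)))"
    unfolding toric_exp_def by (simp add: keys_sum_monomial fin cong: SUP_cong)
  also have "\<dots> = (\<Union>i\<in>keys m. e i)"
    by (rule SUP_cong) (auto simp: in_keys_iff)
  finally show ?thesis .
qed

lemma keys_toric_exp_subset:
  assumes "keys m \<subseteq> {1..N}"
  shows "keys (toric_exp e m) \<subseteq> {1..v}"
  unfolding keys_toric_exp[OF assms]
proof (rule UN_least)
  show "e i \<subseteq> {1..v}" if "i \<in> keys m" for i
    using edge assms that by blast
qed

lemma tdeg_toric_exp:
  assumes "keys m \<subseteq> {1..N}"
  shows "tdeg (toric_exp e m) = 2 * tdeg m"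
proof -
  have "tdeg (toric_exp e m) = (\<Sum>i\<in>keys m. card (e i) * lookup m i)"
    by (simp add: toric_exp_def tdeg_sum)
  also have "\<dots> = (\<Sum>i\<in>keys m. 2 * lookup m i)"
    by (rule sum.cong) (use edge assms in auto)
  finally show ?thesis by (simp add: tdeg_def sum_distrib_left)
qed

lemma toric_hom_ring:
  "ring_hom_ring (mpoly_ring N) (mpoly_ring v) (toric_hom e :: 'k::field mpoly \<Rightarrow> _)"
  unfolding toric_hom_eq
  by (rule mpoly_ring_hom_lin_ext)
    (simp_all only: toric_exp_add mult_single mult_1 toric_exp_zero single_one
      mpoly_single_closed keys_toric_exp_subset)

lemma toric_ideal_ideal: "ideal (toric_ideal v N e :: 'k::field mpoly set) (mpoly_ring N)"
  unfolding toric_ideal_def by (rule ring_hom_ring.kernel_is_ideal[OF toric_hom_ring])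

abbreviation cls :: "'k::field mpoly \<Rightarrow> 'k mpoly set" where
  "cls f \<equiv> toric_ideal v N e +>\<^bsub>mpoly_ring N\<^esub> f"

text \<open>Moves equality in the quotient to the target polynomial ring, where coefficients can be
  compared.\<close>

lemma cls_eq_iff:
  fixes f g :: "'k::field mpoly"
  assumes "f \<in> carrier (mpoly_ring N)" "g \<in> carrier (mpoly_ring N)"
  shows "cls f = cls g \<longleftrightarrow> toric_hom e f = toric_hom e g"
  unfolding toric_ideal_def
    ring_hom_ring.rcos_eq_homeq[OF toric_hom_ring assms(1)]
    ring_hom_ring.rcos_eq_homeq[OF toric_hom_ring assms(2)]
  using assms by auto

lemma toric_ring_carrier: "carrier (toric_ring v N e :: 'k::field mpoly set ring) = cls ` carrier (mpoly_ring N)"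
  by (auto simp: toric_ring_def FactRing_def A_RCOSETS_def')

lemma toric_ring_cring: "cring (toric_ring v N e :: 'k::field mpoly set ring)"
  unfolding toric_ring_def by (rule ideal.quotient_is_cring[OF toric_ideal_ideal mpoly_ring_cring])

lemma cls_ring_hom:
  "ring_hom_ring (mpoly_ring N) (toric_ring v N e) (cls :: 'k::field mpoly \<Rightarrow> _)"
  unfolding toric_ring_def by (rule ideal.rcos_ring_hom_ring[OF toric_ideal_ideal])

lemma cls_simps:
  fixes f g :: "'k::field mpoly"
  assumes "f \<in> carrier (mpoly_ring N)" "g \<in> carrier (mpoly_ring N)"
  shows "cls f \<otimes>\<^bsub>toric_ring v N e\<^esub> cls g = cls (f * g)"
    and "cls f \<oplus>\<^bsub>toric_ring v N e\<^esub> cls g = cls (f + g)"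
    and "\<zero>\<^bsub>toric_ring v N e\<^esub> = cls (0 :: 'k mpoly)"
    and "\<ominus>\<^bsub>toric_ring v N e\<^esub> cls f = cls (- f)"
proof -
  interpret ring_hom_ring "mpoly_ring N" "toric_ring v N e" "cls :: 'k mpoly \<Rightarrow> _"
    by (rule cls_ring_hom)
  show "cls f \<otimes>\<^bsub>toric_ring v N e\<^esub> cls g = cls (f * g)" "cls f \<oplus>\<^bsub>toric_ring v N e\<^esub> cls g = cls (f + g)"
    "\<zero>\<^bsub>toric_ring v N e\<^esub> = cls (0 :: 'k mpoly)"
    using hom_mult[OF assms] hom_add[OF assms] hom_zero by simp_all
  show "\<ominus>\<^bsub>toric_ring v N e\<^esub> cls f = cls (- f)"
    using hom_a_inv[OF assms(1)] by (simp add: mpoly_ring_a_inv[OF assms(1)])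
qed

lemma cls_in_ideal:
  fixes f :: "'k::field mpoly"
  assumes J: "ideal J (toric_ring v N e)" and f: "f \<in> carrier (mpoly_ring N)"
    and m: "\<And>m c. m \<in> keys f \<Longrightarrow> cls (Poly_Mapping.single m c) \<in> J"
  shows "cls f \<in> J"
proof -
  interpret J: ideal J "toric_ring v N e" by (rule J)
  have sgl: "Poly_Mapping.single m (lookup f m) \<in> carrier (mpoly_ring N)" if "m \<in> keys f" for m
    using that f by (auto simp: mpoly_ring_carrier)
  have "cls (\<Sum>m\<in>A. Poly_Mapping.single m (lookup f m)) \<in> J" if "finite A" "A \<subseteq> keys f" for A
    using that
  proof (induction A rule: finite_induct)
    case empty
    then show ?case using additive_subgroup.zero_closed[OF ideal.axioms(1)[OF J]] cls_simps(3)[OF f f]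
      by (simp only: sum.empty)
  next
    case (insert a A)
    have "(\<Sum>m\<in>A. Poly_Mapping.single m (lookup f m)) \<in> carrier (mpoly_ring N)"
      using insert.prems by (intro mpoly_sum_closed sgl) auto
    moreover have "A \<subseteq> keys f" "a \<in> keys f" using insert.prems by auto
    ultimately show ?case
      using additive_subgroup.a_closed[OF ideal.axioms(1)[OF J] m[of a "lookup f a"] insert.IH] sgl[of a] insert.hyps
      by (simp add: cls_simps(2))
  qed
  from this[of "keys f"] show ?thesis
    by (simp flip: mpoly_expand_keys)
qed

lemma cls_order_ge_ideal: "ideal (cls ` order_ge N k :: 'k::field mpoly set set) (toric_ring v N e)"
proof (rule ring_hom_ring.ideal_image_surj[OF cls_ring_hom])
  show "ideal (order_ge N k :: 'k mpoly set) (mpoly_ring N)"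
  proof (rule mpoly_idealI)
    show "f * g \<in> order_ge N k" if "f \<in> carrier (mpoly_ring N)" "g \<in> order_ge N k" for f g :: "'k mpoly"
      using order_ge_mult[of f N 0 g k] that by (simp add: order_ge_0)
  qed (auto simp: order_ge_add order_ge_carrier, simp add: order_ge_def)
qed (simp add: toric_ring_carrier)

lemma monomial_split_var:
  assumes "keys m \<subseteq> {1..N}" "Suc k \<le> tdeg m"
  obtains i where "i \<in> {1..N}" "keys (m - mvar i) \<subseteq> {1..N}" "k \<le> tdeg (m - mvar i)"
    "\<forall>c :: 'k::field. Poly_Mapping.single m c = Poly_Mapping.single (m - mvar i) c * Var i"
proof -
  have "m \<noteq> 0" using assms(2) by auto
  then have "keys m \<noteq> {}" by simp
  then obtain i where i: "i \<in> keys m" by blast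
  have "tdeg m = tdeg (m - mvar i) + 1"
    using tdeg_add[of "m - mvar i" "mvar i"] by (simp add: split_mvar[OF i])
  then show ?thesis
    using i assms keys_minus_monomial[of m "mvar i"]
    by (intro that[of i]) (simp_all only: Var_def mult_single split_mvar[OF i] mult_1_right, auto)
qed

lemma order_ge_keys:
  assumes "f \<in> order_ge N k" "m \<in> keys f"
  shows "keys m \<subseteq> {1..N}" "k \<le> tdeg m"
  using assms by (simp_all add: order_ge_def mpoly_ring_carrier)

lemma Var_order_ge: "i \<in> {1..N} \<Longrightarrow> (Var i :: 'k::field mpoly) \<in> order_ge N 1"
  unfolding Var_def by (rule order_ge_single) auto

lemma toric_origin_eq: "toric_origin v N e = (cls ` order_ge N 1 :: 'k::field mpoly set set)"
proof
  interpret R: cring "toric_ring v N e :: 'k mpoly set ring" by (rule toric_ring_cring)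
  let ?V = "(\<lambda>i. cls (Var i)) ` {1..N} :: 'k mpoly set set"
  have V: "?V \<subseteq> cls ` order_ge N 1" using Var_order_ge by blast
  then show "toric_origin v N e \<subseteq> (cls ` order_ge N 1 :: 'k mpoly set set)"
    unfolding toric_origin_def by (rule R.genideal_minimal[OF cls_order_ge_ideal])
  have Vc: "?V \<subseteq> carrier (toric_ring v N e)"
    unfolding toric_ring_carrier using Var_order_ge order_ge_carrier by blast
  have id: "ideal (toric_origin v N e :: 'k mpoly set set) (toric_ring v N e)"
    unfolding toric_origin_def by (rule R.genideal_ideal[OF Vc])
  show "cls ` order_ge N 1 \<subseteq> (toric_origin v N e :: 'k mpoly set set)"
  proof (rule image_subsetI)
    fix f :: "'k mpoly" assume f: "f \<in> order_ge N 1"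
    show "cls f \<in> toric_origin v N e"
    proof (rule cls_in_ideal[OF id order_ge_carrier[OF f]])
      fix m and c :: 'k assume m: "m \<in> keys f"
      have "keys m \<subseteq> {1..N}" "Suc 0 \<le> tdeg m" using order_ge_keys[OF f m] by simp_all
      then obtain i where i: "i \<in> {1..N}" "keys (m - mvar i) \<subseteq> {1..N}" "0 \<le> tdeg (m - mvar i)"
        and eq': "\<forall>c :: 'k. Poly_Mapping.single m c = Poly_Mapping.single (m - mvar i) c * Var i"
        by (rule monomial_split_var)
      note eq = spec[OF eq']
      have c: "Poly_Mapping.single (m - mvar i) c \<in> carrier (mpoly_ring N)"
        using i(2) by (rule mpoly_single_closed)
      have 1: "cls (Var i) \<in> (toric_origin v N e :: 'k mpoly set set)"
        unfolding toric_origin_def using R.genideal_self[OF Vc] i(1) by blast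
      have 2: "cls (Poly_Mapping.single (m - mvar i) c) \<in> carrier (toric_ring v N e)"
        unfolding toric_ring_carrier using c by (rule imageI)
      show "cls (Poly_Mapping.single m c) \<in> toric_origin v N e"
        using ideal.I_l_closed[OF id 1 2]
        unfolding eq cls_simps(1)[OF c order_ge_carrier[OF Var_order_ge[OF i(1)]]] .
    qed
  qed
qed

text \<open>Orders add under multiplication; conversely, a monomial of degree at least
  \<open>k + 1\<close> is a variable times a monomial of degree at least \<open>k\<close>. The
  zeroth power is the unit of the semiring of ideals, the whole ring.\<close>

lemma toric_origin_power:
  "(toric_origin v N e :: 'k::field mpoly set set) [^]\<^bsub>ideals_set (toric_ring v N e)\<^esub> k = cls ` order_ge N k"
proof (induction k)
  case 0
  show ?case by (simp add: nat_pow_def ideals_set_def toric_ring_carrier order_ge_0)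
next
  case (Suc k)
  interpret R: cring "toric_ring v N e :: 'k mpoly set ring" by (rule toric_ring_cring)
  let ?A = "cls ` order_ge N k :: 'k mpoly set set" and ?B = "cls ` order_ge N 1 :: 'k mpoly set set"
  let ?C = "cls ` order_ge N (Suc k) :: 'k mpoly set set"
  have id: "ideal (ideal_prod (toric_ring v N e) ?A ?B) (toric_ring v N e)"
    by (rule R.ideal_prod_is_ideal[OF cls_order_ge_ideal cls_order_ge_ideal])
  have "ideal_prod (toric_ring v N e) ?A ?B = ?C"
  proof (intro equalityI subsetI)
    fix x assume "x \<in> ideal_prod (toric_ring v N e) ?A ?B"
    then show "x \<in> ?C"
    proof (induction rule: ideal_prod.induct)
      case (prod i j)
      then obtain f g where fg: "i = cls f" "f \<in> order_ge N k" "j = cls g" "g \<in> order_ge N 1" by blast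
      have "f * g \<in> order_ge N (Suc k)" using order_ge_mult[OF fg(2,4)] by simp
      then show ?case
        unfolding fg(1,3) cls_simps(1)[OF order_ge_carrier[OF fg(2)] order_ge_carrier[OF fg(4)]]
        by (rule imageI)
    next
      case (sum s1 s2)
      show ?case
        using additive_subgroup.a_closed[OF ideal.axioms(1)[OF cls_order_ge_ideal] sum.IH] .
    qed
  next
    fix x assume "x \<in> ?C"
    then obtain f where f: "x = cls f" "f \<in> order_ge N (Suc k)" by blast
    show "x \<in> ideal_prod (toric_ring v N e) ?A ?B"
      unfolding f(1)
    proof (rule cls_in_ideal[OF id order_ge_carrier[OF f(2)]])
      fix m and c :: 'k assume m: "m \<in> keys f"
      obtain i where i: "i \<in> {1..N}" "keys (m - mvar i) \<subseteq> {1..N}" "k \<le> tdeg (m - mvar i)"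
        and eq': "\<forall>c :: 'k. Poly_Mapping.single m c = Poly_Mapping.single (m - mvar i) c * Var i"
        using order_ge_keys[OF f(2) m] by (rule monomial_split_var)
      note eq = spec[OF eq']
      have a: "Poly_Mapping.single (m - mvar i) c \<in> order_ge N k"
        using i(2,3) by (rule order_ge_single)
      have "cls (Poly_Mapping.single (m - mvar i) c) \<otimes>\<^bsub>toric_ring v N e\<^esub> cls (Var i)
          \<in> ideal_prod (toric_ring v N e) ?A ?B"
        by (intro ideal_prod.prod imageI a Var_order_ge i)
      then show "cls (Poly_Mapping.single m c) \<in> ideal_prod (toric_ring v N e) ?A ?B"
        unfolding eq cls_simps(1)[OF order_ge_carrier[OF a] order_ge_carrier[OF Var_order_ge[OF i(1)]]] .
    qed
  qed
  then show ?case
    using Suc.IH by (simp add: nat_pow_def ideals_set_def toric_origin_eq)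
qed

lemma tdeg_toric_hom:
  assumes "g \<in> order_ge N k" "u \<in> keys (toric_hom e g)"
  shows "2 * k \<le> tdeg u"
proof -
  obtain m where m: "m \<in> keys g" "u = toric_exp e m" using assms(2) keys_toric_hom by blast
  show ?thesis using order_ge_keys[OF assms(1) m(1)] m(2) by (simp add: tdeg_toric_exp)
qed

text \<open>\<open>toric_exp\<close> doubles degrees, so low-order and high-order terms cannot
  cancel each other in the image. If the image of \<open>f\<close> has only high degrees, the
  low-order part of \<open>f\<close> is mapped to zero and may be dropped without changing the
  class.\<close>

lemma cls_mem_order_ge_iff:
  fixes f :: "'k::field mpoly"
  assumes f: "f \<in> carrier (mpoly_ring N)"
  shows "cls f \<in> cls ` order_ge N k \<longleftrightarrow> (\<forall>u\<in>keys (toric_hom e f). 2 * k \<le> tdeg u)"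
proof
  assume "cls f \<in> cls ` order_ge N k"
  then obtain g where g: "g \<in> order_ge N k" "cls f = cls g" by blast
  then have "toric_hom e f = toric_hom e g"
    using cls_eq_iff[OF f order_ge_carrier[OF g(1)]] by simp
  then show "\<forall>u\<in>keys (toric_hom e f). 2 * k \<le> tdeg u" using tdeg_toric_hom[OF g(1)] by simp
next
  assume u: "\<forall>u\<in>keys (toric_hom e f). 2 * k \<le> tdeg u"
  define A where "A = {m \<in> keys f. k \<le> tdeg m}"
  define B where "B = {m \<in> keys f. \<not> k \<le> tdeg m}"
  define g where "g = (\<Sum>m\<in>A. Poly_Mapping.single m (lookup f m))"
  define g' where "g' = (\<Sum>m\<in>B. Poly_Mapping.single m (lookup f m))"
  have "f = (\<Sum>m\<in>A \<union> B. Poly_Mapping.single m (lookup f m))"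
    by (rule mpoly_expand) (auto simp: A_def B_def)
  also have "\<dots> = g + g'"
    unfolding g_def g'_def by (rule sum.union_disjoint) (auto simp: A_def B_def)
  finally have fs: "f = g + g'" .
  have kg: "keys g \<subseteq> A" "keys g' \<subseteq> B"
    using keys_sum[of "\<lambda>m. Poly_Mapping.single m (lookup f m)" A] keys_sum[of "\<lambda>m. Poly_Mapping.single m (lookup f m)" B]
    by (auto simp: g_def g'_def split: if_splits)
  have g: "g \<in> order_ge N k"
    using kg(1) f by (auto simp: order_ge_def mpoly_ring_carrier A_def)
  have "keys (toric_hom e g') = {}"
  proof (rule equals0I)
    fix x assume x: "x \<in> keys (toric_hom e g')"
    then obtain m where m: "m \<in> keys g'" "x = toric_exp e m" using keys_toric_hom by blast
    then have "m \<in> B" using kg(2) by blast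
    then have "keys m \<subseteq> {1..N}" "tdeg m < k" using f by (simp_all add: B_def mpoly_ring_carrier)
    then have "tdeg x < 2 * k" using m tdeg_toric_exp by simp
    moreover have "toric_hom e g' = toric_hom e f + - toric_hom e g"
      by (simp add: fs toric_hom_add)
    then have "x \<in> keys (toric_hom e f) \<union> keys (toric_hom e g)"
      using x keys_add[of "toric_hom e f" "- toric_hom e g"] by auto
    then have "2 * k \<le> tdeg x" using u tdeg_toric_hom[OF g] by blast
    ultimately show False by simp
  qed
  then have "toric_hom e f = toric_hom e g" by (simp add: fs toric_hom_add)
  then have "cls f = cls g" using cls_eq_iff[OF f order_ge_carrier[OF g]] by blast
  then show "cls f \<in> cls ` order_ge N k" using g by blast
qed


text \<open>The chosen monomials have distinct images, so the coefficients of a combination can be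
  recovered from its image. \<open>combine\<close> stops at the end of the shorter list, hence the
  two bounds on \<open>i\<close>.\<close>

lemma combine_monomials:
  fixes cs :: "'k::field list"
  assumes "distinct us" "\<And>u. u \<in> set us \<Longrightarrow> toric_exp e (rep u) = u"
  defines "g \<equiv> ring.combine (mpoly_ring N) (map Const cs) (map (\<lambda>u. monom_of (rep u)) us)"
  shows "\<And>u. u \<notin> set us \<Longrightarrow> lookup (toric_hom e g) u = 0"
    and "\<And>i. i < length us \<Longrightarrow> i < length cs \<Longrightarrow> lookup (toric_hom e g) (us ! i) = cs ! i"
proof -
  interpret ring "mpoly_ring N :: 'k mpoly ring"
    using mpoly_ring_cring by (rule cring.axioms(1))
  have "(\<forall>u. u \<notin> set us \<longrightarrow> lookup (toric_hom e g) u = 0) \<and>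
      (\<forall>i. i < length us \<longrightarrow> i < length cs \<longrightarrow> lookup (toric_hom e g) (us ! i) = cs ! i)"
    using assms(1,2) unfolding g_def
  proof (induction us arbitrary: cs)
    case (Cons u us)
    show ?case
    proof (cases cs)
      case (Cons c cs')
      have "toric_hom e (combine (map Const cs) (map (\<lambda>u. monom_of (rep u)) (u # us))) =
          Poly_Mapping.single u c + toric_hom e (combine (map Const cs') (map (\<lambda>u. monom_of (rep u)) us))"
        using Cons.prems by (simp add: Cons toric_hom_add Const_mult_single toric_hom_single)
      then have l: "lookup (toric_hom e (combine (map Const cs) (map (\<lambda>u. monom_of (rep u)) (u # us)))) x =
          (if u = x then c else 0) + lookup (toric_hom e (combine (map Const cs') (map (\<lambda>u. monom_of (rep u)) us))) x" for x
        by (simp only: lookup_add lookup_single when_def)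
      have IH: "(\<forall>x. x \<notin> set us \<longrightarrow> lookup (toric_hom e (combine (map Const cs') (map (\<lambda>u. monom_of (rep u)) us))) x = 0) \<and>
          (\<forall>i. i < length us \<longrightarrow> i < length cs' \<longrightarrow>
            lookup (toric_hom e (combine (map Const cs') (map (\<lambda>u. monom_of (rep u)) us))) (us ! i) = cs' ! i)"
        using Cons.prems by (intro Cons.IH) auto
      show ?thesis
        unfolding l
      proof (intro conjI allI impI)
        show "(if u = x then c else 0) + lookup (toric_hom e (combine (map Const cs') (map (\<lambda>u. monom_of (rep u)) us))) x = 0"
          if "x \<notin> set (u # us)" for x
          using that IH by auto
        show "(if u = (u # us) ! i then c else 0) +
            lookup (toric_hom e (combine (map Const cs') (map (\<lambda>u. monom_of (rep u)) us))) ((u # us) ! i) = cs ! i"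
          if "i < length (u # us)" "i < length cs" for i
        proof (cases i)
          case 0
          then show ?thesis using IH Cons.prems(1) \<open>cs = c # cs'\<close> by simp
        next
          case (Suc j)
          then have "j < length us" "j < length cs'" using that \<open>cs = c # cs'\<close> by auto
          moreover from this have "u \<noteq> us ! j" using Cons.prems(1) by auto
          ultimately show ?thesis using IH Suc \<open>cs = c # cs'\<close> by simp
        qed
      qed
    qed simp
  qed simp
  then show "\<And>u. u \<notin> set us \<Longrightarrow> lookup (toric_hom e g) u = 0"
    "\<And>i. i < length us \<Longrightarrow> i < length cs \<Longrightarrow> lookup (toric_hom e g) (us ! i) = cs ! i"
    by simp_all
qed

text \<open>One monomial \<open>rep u\<close> is chosen for each exponent \<open>u\<close>. These
  are independent because their images have degree \<open>2 * k\<close>, which is too low to vanish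
  modulo \<open>J\<close>; they span because terms with the same exponent have the same
  class.\<close>

lemma graded_piece_dimension_toric:
  "graded_piece_dimension (toric_ring v N e :: 'k::field mpoly set ring)
     (toric_constants v N e) (toric_origin v N e) k (card (toric_exps N e k))"
proof -
  let ?P = "mpoly_ring N :: 'k mpoly ring"
  let ?R = "toric_ring v N e :: 'k mpoly set ring"
  define J where "J = (cls ` order_ge N (Suc k) :: 'k mpoly set set)"
  define \<Psi> where "\<Psi> f = J +>\<^bsub>?R\<^esub> cls f" for f :: "'k mpoly"
  have J: "ideal J ?R" unfolding J_def by (rule cls_order_ge_ideal)
  interpret J: ideal J ?R by (rule J)
  have "\<Psi> \<in> ring_hom ?P (?R Quot J)"
  proof -
    have "(+>\<^bsub>?R\<^esub>) J \<circ> cls \<in> ring_hom ?P (?R Quot J)"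
      using ring_hom_ring.homh[OF cls_ring_hom] J.rcos_ring_hom by (rule ring_hom_trans)
    moreover have "(+>\<^bsub>?R\<^esub>) J \<circ> cls = \<Psi>" by (rule ext) (simp add: \<Psi>_def)
    ultimately show ?thesis by simp
  qed
  then interpret \<Psi>: ring_hom_ring ?P "?R Quot J" \<Psi>
    using cring.axioms(1)[OF mpoly_ring_cring] J.quotient_is_ring by (intro ring_hom_ringI2)
  have cls_carrier: "cls f \<in> carrier ?R" if "f \<in> carrier ?P" for f :: "'k mpoly"
    unfolding toric_ring_carrier using that by (rule imageI)
  have zero_iff: "\<Psi> f = \<zero>\<^bsub>?R Quot J\<^esub> \<longleftrightarrow> (\<forall>u\<in>keys (toric_hom e f). 2 * Suc k \<le> tdeg u)"
    if f: "f \<in> carrier ?P" for f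
  proof -
    have "\<zero>\<^bsub>?R Quot J\<^esub> = J" by (simp add: FactRing_def)
    moreover have "J +>\<^bsub>?R\<^esub> cls f = J \<longleftrightarrow> cls f \<in> J"
      using J.a_rcos_const J.a_rcos_self[OF cls_carrier[OF f]] by auto
    ultimately show ?thesis
      unfolding \<Psi>_def J_def using cls_mem_order_ge_iff[OF f, of "Suc k"] by simp
  qed
  let ?E = "toric_exps N e k"
  define rep where "rep u = (SOME m. keys m \<subseteq> {1..N} \<and> tdeg m = k \<and> toric_exp e m = u)" for u
  have rep: "keys (rep u) \<subseteq> {1..N} \<and> tdeg (rep u) = k \<and> toric_exp e (rep u) = u" if "u \<in> ?E" for u
    unfolding rep_def by (rule someI_ex) (use that in \<open>auto simp: toric_exps_def\<close>)
  obtain us where us: "set us = ?E" "distinct us"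
    using finite_distinct_list[OF finite_toric_exps] by blast
  have len: "length us = card ?E" using distinct_card[OF us(2)] us(1) by simp
  have deg: "tdeg u = 2 * k" if "u \<in> set us" for u
    using rep[of u] that tdeg_toric_exp[of "rep u"] us(1) by simp
  define ms where "ms = map (\<lambda>u. monom_of (rep u) :: 'k mpoly) us"
  have ms: "set ms \<subseteq> carrier ?P"
    unfolding ms_def using rep us(1) by auto
  have len_ms: "length ms = length us" by (simp add: ms_def)
  define g where "g cs = \<Psi>.R.combine (map Const cs) ms" for cs
  have g_carrier: "g cs \<in> carrier ?P" for cs
    unfolding g_def using ms by (intro \<Psi>.R.combine_in_carrier) auto
  have rep': "toric_exp e (rep u) = u" if "u \<in> set us" for u using rep that us(1) by simp
  have g_lookup: "u \<notin> set us \<Longrightarrow> lookup (toric_hom e (g cs)) u = 0"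
    "i < length us \<Longrightarrow> i < length cs \<Longrightarrow> lookup (toric_hom e (g cs)) (us ! i) = cs ! i" for u i cs
    unfolding g_def ms_def using combine_monomials[of us rep] us(2) rep' by blast+
  have combine: "\<Psi>.S.combine (map \<Psi> (map Const cs)) (map \<Psi> ms) = \<Psi> (g cs)" for cs
    unfolding g_def using ms by (intro \<Psi>.combine_hom) auto
  let ?K = "\<Psi> ` range Const"
  \<comment> \<open>The image of \<open>1\<close> has degree \<open>0\<close>, below
    \<open>2 * Suc k\<close>. So \<open>J\<close> is proper, and the image of the constants is a
    field, not the zero ring.\<close>
  have "\<Psi> 1 \<noteq> \<zero>\<^bsub>?R Quot J\<^esub>"
    by (subst zero_iff) auto
  then have "\<one>\<^bsub>?R Quot J\<^esub> \<noteq> \<zero>\<^bsub>?R Quot J\<^esub>"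
    using \<Psi>.hom_one by simp
  then have K: "subfield ?K (?R Quot J)"
    by (rule \<Psi>.img_is_subfield(2)[OF Const_subfield])
  have K_list: "\<exists>cs. Ks = map \<Psi> (map Const cs)" if "set Ks \<subseteq> ?K" for Ks
    using that
  proof (induction Ks)
    case (Cons x Ks)
    then obtain c cs where "x = \<Psi> (Const c)" "Ks = map \<Psi> (map Const cs)" by auto
    then show ?case by (intro exI[of _ "c # cs"]) simp
  qed simp
  have Us: "set (map \<Psi> ms) \<subseteq> carrier (?R Quot J)"
    using ms by auto
  have indep: "\<Psi>.S.independent ?K (map \<Psi> ms)"
  proof (rule \<Psi>.S.trivial_combine_imp_independent[OF K Us])
    fix Ks assume Ks: "set Ks \<subseteq> ?K" "\<Psi>.S.combine Ks (map \<Psi> ms) = \<zero>\<^bsub>?R Quot J\<^esub>"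
    then obtain cs where cs: "Ks = map \<Psi> (map Const cs)" using K_list by blast
    have z: "\<forall>u\<in>keys (toric_hom e (g cs)). 2 * Suc k \<le> tdeg u"
      using Ks(2) zero_iff[OF g_carrier] by (simp only: cs combine)
    have "cs ! i = 0" if i: "i < length us" "i < length cs" for i
    proof (rule ccontr)
      assume "cs ! i \<noteq> 0"
      then have "us ! i \<in> keys (toric_hom e (g cs))"
        using g_lookup(2)[OF i] by (simp add: in_keys_iff)
      then have "2 * Suc k \<le> tdeg (us ! i)" using z by blast
      then show False using deg[of "us ! i"] i by simp
    qed
    then have "x = \<zero>\<^bsub>?R Quot J\<^esub>" if x: "x \<in> set (take (length us) Ks)" for x
    proof -
      obtain i where i: "i < length us" "i < length cs" "x = \<Psi> (Const (cs ! i))"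
        using x unfolding cs by (auto simp: in_set_conv_nth)
      then have "cs ! i = 0" using \<open>\<And>i. i < length us \<Longrightarrow> i < length cs \<Longrightarrow> cs ! i = 0\<close> by simp
      then show ?thesis using i(3) \<Psi>.hom_zero by simp
    qed
    then show "set (take (length (map \<Psi> ms)) Ks) \<subseteq> {\<zero>\<^bsub>?R Quot J\<^esub>}"
      by (auto simp: len_ms)
  qed
  have span: "\<Psi>.S.Span ?K (map \<Psi> ms) = (+>\<^bsub>?R\<^esub>) J ` cls ` order_ge N k"
  proof (intro equalityI subsetI)
    fix x assume "x \<in> \<Psi>.S.Span ?K (map \<Psi> ms)"
    then obtain Ks where "set Ks \<subseteq> ?K" "x = \<Psi>.S.combine Ks (map \<Psi> ms)"
      using \<Psi>.S.Span_eq_combine_set[OF K Us] by blast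
    then obtain cs where x: "x = \<Psi> (g cs)" using K_list combine by metis
    have "2 * k \<le> tdeg u" if "u \<in> keys (toric_hom e (g cs))" for u
      using g_lookup(1)[of u cs] deg[of u] that by (cases "u \<in> set us") (auto simp: in_keys_iff)
    then have "cls (g cs) \<in> cls ` order_ge N k"
      using cls_mem_order_ge_iff[OF g_carrier] by blast
    then show "x \<in> (+>\<^bsub>?R\<^esub>) J ` cls ` order_ge N k"
      unfolding x \<Psi>_def by (rule imageI)
  next
    fix x assume "x \<in> (+>\<^bsub>?R\<^esub>) J ` cls ` order_ge N k"
    then obtain f where f: "f \<in> order_ge N k" "x = \<Psi> f" unfolding \<Psi>_def by blast
    note fc = order_ge_carrier[OF f(1)]
    \<comment> \<open>The coefficients of the image of \<open>f\<close> in degree exactly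
      \<open>2 * k\<close>; subtracting \<open>g cs\<close> leaves an image with higher degrees
      only, that is, an element of the kernel of \<open>\<Psi>\<close>.\<close>
    define cs where "cs = map (lookup (toric_hom e f)) us"
    have dc: "f - g cs \<in> carrier ?P" using fc g_carrier by (rule mpoly_diff_closed)
    have "2 * Suc k \<le> tdeg u" if u: "u \<in> keys (toric_hom e (f - g cs))" for u
    proof -
      have ne: "lookup (toric_hom e f) u \<noteq> lookup (toric_hom e (g cs)) u"
        using u by (simp add: toric_hom_diff lookup_minus in_keys_iff)
      have nu: "u \<notin> set us"
      proof
        assume "u \<in> set us"
        then obtain i where i: "i < length us" "u = us ! i" by (metis in_set_conv_nth)
        then show False using ne g_lookup(2)[of i cs] by (simp add: cs_def)
      qed
      then have "u \<in> keys (toric_hom e f)"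
        using ne g_lookup(1)[OF nu, of cs] by (simp add: in_keys_iff)
      then obtain m where m: "m \<in> keys f" "u = toric_exp e m" using keys_toric_hom by blast
      note mk = order_ge_keys[OF f(1) m(1)]
      then have "tdeg m \<noteq> k" using nu m(2) us(1) by (auto simp: toric_exps_def)
      then show ?thesis using mk m(2) tdeg_toric_exp[OF mk(1)] by simp
    qed
    then have "\<Psi> (f - g cs) = \<zero>\<^bsub>?R Quot J\<^esub>" using zero_iff[OF dc] by blast
    moreover have "\<Psi> ((f - g cs) + g cs) = \<Psi> (f - g cs) \<oplus>\<^bsub>?R Quot J\<^esub> \<Psi> (g cs)"
      using \<Psi>.hom_add[OF dc g_carrier[of cs]] by (simp only: mpoly_ring_simps)
    ultimately have "\<Psi> f = \<Psi> (g cs)" using \<Psi>.hom_closed[OF g_carrier] by simp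
    then have "x = \<Psi>.S.combine (map \<Psi> (map Const cs)) (map \<Psi> ms)"
      using f(2) combine by simp
    moreover have "set (map \<Psi> (map Const cs)) \<subseteq> ?K" by auto
    ultimately show "x \<in> \<Psi>.S.Span ?K (map \<Psi> ms)"
      using \<Psi>.S.Span_eq_combine_set[OF K Us] by blast
  qed
  have "\<Psi>.S.dimension (length (map \<Psi> ms)) ?K (\<Psi>.S.Span ?K (map \<Psi> ms))"
    by (rule \<Psi>.S.dimension_independent[OF indep])
  then have "\<Psi>.S.dimension (card ?E) ?K ((+>\<^bsub>?R\<^esub>) J ` cls ` order_ge N k)"
    by (simp only: span length_map len_ms len)
  moreover have "(+>\<^bsub>?R\<^esub>) J ` toric_constants v N e = ?K"
    unfolding toric_constants_def \<Psi>_def by (simp add: image_image)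
  ultimately show ?thesis
    unfolding graded_piece_dimension_def Let_def toric_origin_power
    by (simp add: J_def)
qed

end

section \<open>Upper bound for the Krull dimension\<close>

definition power_product :: "'k::field mpoly list \<Rightarrow> nat list \<Rightarrow> 'k mpoly" where
  "power_product fs as = prod_list (map2 (^) fs as)"

lemma power_product_simps [simp]:
  "power_product [] as = 1" "power_product fs [] = 1"
  "power_product (f # fs) (a # as) = f ^ a * power_product fs as"
  by (simp_all add: power_product_def)

lemma mpoly_power_closed: "f \<in> carrier (mpoly_ring r) \<Longrightarrow> f ^ j \<in> carrier (mpoly_ring r)"
  by (induction j) (auto intro: mpoly_mult_closed)

lemma power_product_closed:
  "set fs \<subseteq> carrier (mpoly_ring r) \<Longrightarrow> power_product fs as \<in> carrier (mpoly_ring r)"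
proof (induction fs arbitrary: as)
  case (Cons f fs)
  then show ?case
    by (cases as) (auto intro!: mpoly_mult_closed mpoly_power_closed)
qed simp

lemma mpoly_ideal_closed:
  fixes I :: "'k::field mpoly set"
  assumes "ideal I (mpoly_ring r)"
  shows "f \<in> I \<Longrightarrow> f \<in> carrier (mpoly_ring r)"
    and "0 \<in> I"
    and "f \<in> I \<Longrightarrow> g \<in> I \<Longrightarrow> f + g \<in> I"
    and "f \<in> I \<Longrightarrow> g \<in> I \<Longrightarrow> f - g \<in> I"
    and "f \<in> I \<Longrightarrow> g \<in> carrier (mpoly_ring r) \<Longrightarrow> f * g \<in> I"
proof -
  interpret ideal I "mpoly_ring r" by (rule assms)
  show carr: "f \<in> carrier (mpoly_ring r)" if "f \<in> I" for f using that by (rule Icarr)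
  show "0 \<in> I" using additive_subgroup.zero_closed[OF is_additive_subgroup] by simp
  show add: "f + g \<in> I" if "f \<in> I" "g \<in> I" for f g
    using additive_subgroup.a_closed[OF is_additive_subgroup that] by simp
  show mul: "f * g \<in> I" if "f \<in> I" "g \<in> carrier (mpoly_ring r)" for f g
    using I_r_closed[OF that] by simp
  have "- g \<in> I" if "g \<in> I" for g
    using mul[OF that, of "-1"] mpoly_uminus_closed[OF mpoly_one_closed[of r]] by simp
  then show "f - g \<in> I" if "f \<in> I" "g \<in> I" for f g
    using add[of f "- g"] that by simp
qed

lemma Const_in_prime_ideal:
  fixes Q :: "'k::field mpoly set"
  assumes "primeideal Q (mpoly_ring r)" "Const c \<in> Q"
  shows "c = 0"
proof (rule ccontr)
  assume "c \<noteq> 0"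
  interpret primeideal Q "mpoly_ring r" by (rule assms)
  have "Const c * Const (inverse c) \<in> Q"
    using mpoly_ideal_closed(5)[OF is_ideal assms(2)] by simp
  then have "1 \<in> Q" using \<open>c \<noteq> 0\<close> by (simp flip: Const_mult)
  then have "Q = carrier (mpoly_ring r)" using one_imp_carrier by simp
  then show False using I_notcarr by simp
qed

text \<open>
  Algebraic independence of the \<open>f i\<close> modulo \<open>Q 0\<close>: modulo \<open>Q 1\<close> only the terms without \<open>f 0\<close> survive, so
  their coefficients vanish by induction; then \<open>f 0\<close> can be cancelled modulo the prime \<open>Q 0\<close>.
\<close>

lemma prime_chain_independent:
  fixes Q :: "nat \<Rightarrow> 'k::field mpoly set"
  assumes "\<And>i. i \<le> l \<Longrightarrow> primeideal (Q i) (mpoly_ring r)"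
    and "\<And>i. i < l \<Longrightarrow> Q i \<subseteq> Q (Suc i) \<and> f i \<in> Q (Suc i) \<and> f i \<notin> Q i"
    and "finite A" "\<And>as. as \<in> A \<Longrightarrow> length as = l"
    and "(\<Sum>as\<in>A. Const (c as) * power_product (map f [0..<l]) as) \<in> Q 0"
  shows "\<forall>as\<in>A. c as = 0"
  using assms
proof (induction l arbitrary: Q f A c)
  case 0
  show ?case
  proof
    fix as assume as: "as \<in> A"
    then have "A = {[]}" "as = []" using "0.prems"(4) by auto
    then have "Const (c as) \<in> Q 0" using "0.prems"(5) by simp
    then show "c as = 0" by (rule Const_in_prime_ideal[OF "0.prems"(1)[of 0, simplified]])
  qed
next
  case (Suc l)
  note outer = Suc.IH and primes = Suc.prems(1) and chain = Suc.prems(2)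
  let ?P = "carrier (mpoly_ring r) :: 'k mpoly set"
  have I: "ideal (Q i) (mpoly_ring r)" if "i \<le> Suc l" for i
    using Suc.prems(1)[OF that] by (rule primeideal.axioms(1))
  have fc: "f i \<in> ?P" if "i \<le> l" for i
    using Suc.prems(2)[of i] I[of "Suc i"] that mpoly_ideal_closed(1) by auto
  define fs where "fs = map (\<lambda>i. f (Suc i)) [0..<l]"
  have fs: "map f [0..<Suc l] = f 0 # fs"
    unfolding fs_def by (simp add: map_upt_Suc del: upt_Suc)
  have fs_c: "set fs \<subseteq> ?P" unfolding fs_def using fc by auto
  \<comment> \<open>Inner induction on a bound for the exponent of \<open>f 0\<close>: cancelling
    one factor \<open>f 0\<close> lowers every remaining exponent of it by one.\<close>
  have main: "\<forall>as\<in>A. c as = 0"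
    if "finite A" "\<And>as. as \<in> A \<Longrightarrow> length as = Suc l \<and> hd as < b"
      "(\<Sum>as\<in>A. Const (c as) * power_product (f 0 # fs) as) \<in> Q 0" for b A and c :: "nat list \<Rightarrow> 'k"
    using that
  proof (induction b arbitrary: A c)
    case 0
    then have "A = {}" by auto
    then show ?case by simp
  next
    case (Suc b)
    define A0 where "A0 = {as \<in> A. hd as = 0}"
    define A1 where "A1 = {as \<in> A. hd as \<noteq> 0}"
    have A: "A = A0 \<union> A1" "A0 \<inter> A1 = {}" "finite A0" "finite A1"
      using Suc.prems(1) by (auto simp: A0_def A1_def)
    have A0_Cons: "\<exists>bs. as = 0 # bs \<and> length bs = l" if "as \<in> A0" for as
      using that Suc.prems(2)[of as] by (cases as) (auto simp: A0_def)
    have A1_Cons: "\<exists>j bs. as = Suc j # bs \<and> length bs = l \<and> j < b" if "as \<in> A1" for as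
    proof (cases as)
      case (Cons a bs)
      then show ?thesis
        using that Suc.prems(2)[of as] by (cases a) (auto simp: A1_def)
    qed (use that Suc.prems(2)[of as] in \<open>auto simp: A1_def\<close>)
    define t where "t c as = Const (c as) * power_product (f 0 # fs) as" for c :: "nat list \<Rightarrow> 'k" and as
    have t_closed: "t c as \<in> ?P" for c as
      unfolding t_def using fc[of 0] fs_c by (intro mpoly_mult_closed power_product_closed) auto
    define dec where "dec as = (hd as - 1) # tl as" for as :: "nat list"
    define inc where "inc as = Suc (hd as) # tl as" for as :: "nat list"
    have inc_dec: "inc (dec as) = as" if "as \<in> A1" for as
      using A1_Cons[OF that] by (auto simp: inc_def dec_def)
    have inj: "inj_on dec A1" by (metis inc_dec inj_on_def)
    define c' where "c' as = c (inc as)" for as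
    have A1_sum: "(\<Sum>as\<in>A1. t c as) = f 0 * (\<Sum>as\<in>dec ` A1. t c' as)"
    proof -
      have "t c as = f 0 * t c' (dec as)" if as: "as \<in> A1" for as
        using A1_Cons[OF as] inc_dec[OF as] by (auto simp: t_def c'_def dec_def ac_simps)
      then show ?thesis by (simp add: sum.reindex[OF inj] sum_distrib_left)
    qed
    have S: "(\<Sum>as\<in>A0. t c as) + (\<Sum>as\<in>A1. t c as) \<in> Q 0"
      using Suc.prems(3) A(2-4) by (simp add: A(1) t_def sum.union_disjoint)
    have dec_closed: "(\<Sum>as\<in>dec ` A1. t c' as) \<in> ?P" by (intro mpoly_sum_closed t_closed)
    have "(\<Sum>as\<in>A1. t c as) \<in> Q (Suc 0)"
      unfolding A1_sum using chain[of 0]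
      by (intro mpoly_ideal_closed(5)[OF I] dec_closed) auto
    moreover have "(\<Sum>as\<in>A0. t c as) + (\<Sum>as\<in>A1. t c as) \<in> Q (Suc 0)"
      using S chain[of 0] by auto
    ultimately have "(\<Sum>as\<in>A0. t c as) \<in> Q (Suc 0)"
      using mpoly_ideal_closed(4)[OF I[of "Suc 0"]] by fastforce
    moreover have "(\<Sum>as\<in>A0. t c as) = (\<Sum>bs\<in>tl ` A0. Const (c (0 # bs)) * power_product fs bs)"
    proof -
      have "inj_on tl A0" using A0_Cons by (intro inj_onI) (metis list.sel(3))
      moreover have "t c as = Const (c (0 # tl as)) * power_product fs (tl as)" if "as \<in> A0" for as
        using A0_Cons[OF that] by (auto simp: t_def)
      ultimately show ?thesis by (simp add: sum.reindex)
    qed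
    ultimately have "(\<Sum>bs\<in>tl ` A0. Const (c (0 # bs)) * power_product fs bs) \<in> Q (Suc 0)" by simp
    moreover have "length bs = l" if "bs \<in> tl ` A0" for bs
      using that A0_Cons by force
    ultimately have "\<forall>bs\<in>tl ` A0. c (0 # bs) = 0"
      unfolding fs_def using A(3) chain primes
      by (intro outer[of "\<lambda>i. Q (Suc i)" "\<lambda>i. f (Suc i)"]) auto
    then have z0: "\<forall>as\<in>A0. c as = 0" using A0_Cons by force
    then have "(\<Sum>as\<in>A0. t c as) = 0" by (simp add: t_def)
    then have "f 0 * (\<Sum>as\<in>dec ` A1. t c' as) \<in> Q 0" using S A1_sum by simp
    then have "(\<Sum>as\<in>dec ` A1. t c' as) \<in> Q 0"
      using primeideal.I_prime[OF primes[of 0] fc[of 0] dec_closed] chain[of 0] by auto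
    then have "\<forall>as\<in>dec ` A1. c' as = 0"
      unfolding t_def using A(4) A1_Cons
      by (intro Suc.IH) (force simp: dec_def)+
    then have "\<forall>as\<in>A1. c as = 0" using inc_dec by (auto simp: c'_def)
    then show ?case using z0 A(1) by auto
  qed
  have "\<exists>b. \<forall>as\<in>A. hd as < b"
    using finite_nat_set_iff_bounded[of "hd ` A"] Suc.prems(3) by auto
  then obtain b where "\<And>as. as \<in> A \<Longrightarrow> hd as < b" by blast
  then show ?case
    using main[of A b c] Suc.prems(3-5) by (simp only: fs) blast
qed

text \<open>The family lies in the span of the monomials in \<open>U\<close>. Independence is stated
  for an indexed family; the relation \<open>p a - p b\<close> shows that no member is repeated, so
  the dimension bound for sets applies.\<close>

lemma independent_family_card_le:
  fixes p :: "'a \<Rightarrow> 'k::field mpoly"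
  assumes "finite A" "finite U" "\<And>a. a \<in> A \<Longrightarrow> keys (p a) \<subseteq> U"
    and indep: "\<And>c. (\<Sum>a\<in>A. Const (c a) * p a) = 0 \<Longrightarrow> \<forall>a\<in>A. c a = 0"
  shows "card A \<le> card U"
proof -
  interpret vs: vector_space "\<lambda>c (q :: 'k mpoly). Const c * q"
    by unfold_locales (simp_all add: distrib_left distrib_right Const_add Const_mult mult.assoc)
  have inj: "inj_on p A"
  proof (rule inj_onI, rule ccontr)
    fix a b assume ab: "a \<in> A" "b \<in> A" "p a = p b" "a \<noteq> b"
    let ?c = "\<lambda>x. if x = a then 1 else if x = b then - 1 else (0 :: 'k)"
    have "(\<Sum>x\<in>A. Const (?c x) * p x) = (\<Sum>x\<in>{a, b}. Const (?c x) * p x)"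
      using assms(1) ab by (intro sum.mono_neutral_right) auto
    also have "\<dots> = p a + Const (- 1) * p b" using ab(4) by simp
    also have "\<dots> = 0" using ab(3) by (intro poly_mapping_eqI) (simp add: lookup_add)
    finally show False using indep[of ?c] ab(1) by auto
  qed
  have "vs.independent (p ` A)"
  proof (rule ccontr)
    assume "\<not> vs.independent (p ` A)"
    then obtain u where u: "\<exists>q\<in>p ` A. u q \<noteq> 0" "(\<Sum>q\<in>p ` A. Const (u q) * q) = 0"
      using vs.dependent_finite[of "p ` A"] assms(1) by auto
    then have "(\<Sum>a\<in>A. Const (u (p a)) * p a) = 0" by (simp add: sum.reindex[OF inj])
    then show False using indep[of "\<lambda>a. u (p a)"] u(1) by auto
  qed
  moreover have "p ` A \<subseteq> vs.span (monom_of ` U)"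
  proof safe
    fix a assume a: "a \<in> A"
    have "p a = (\<Sum>m\<in>U. Const (lookup (p a) m) * monom_of m)"
      using mpoly_expand[OF assms(2) assms(3)[OF a]] by (simp add: Const_mult_single)
    also have "\<dots> \<in> vs.span (monom_of ` U)"
      by (intro vs.span_sum vs.span_scale vs.span_base imageI)
    finally show "p a \<in> vs.span (monom_of ` U)" .
  qed
  ultimately have "card (p ` A) \<le> card (monom_of ` U :: 'k mpoly set)"
    using vs.independent_span_bound[of "monom_of ` U" "p ` A"] assms(2) by auto
  also have "\<dots> \<le> card U" by (rule card_image_le[OF assms(2)])
  finally show ?thesis by (simp add: card_image[OF inj])
qed

lemma tdeg_power_product:
  fixes fs :: "'k::field mpoly list"
  assumes "\<And>f m. f \<in> set fs \<Longrightarrow> m \<in> keys f \<Longrightarrow> tdeg m \<le> D"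
    and "\<And>a. a \<in> set as \<Longrightarrow> a \<le> k"
  shows "m \<in> keys (power_product fs as) \<Longrightarrow> tdeg m \<le> length fs * (k * D)"
  using assms
proof (induction fs arbitrary: as m)
  case (Cons f fs)
  have pow: "tdeg m \<le> j * D" if "m \<in> keys (f ^ j)" for m j
    using that
  proof (induction j arbitrary: m)
    case (Suc j)
    then obtain a b where "m = a + b" "a \<in> keys f" "b \<in> keys (f ^ j)"
      using keys_mult[of f "f ^ j"] by auto
    then show ?case using Suc.IH[of b] Cons.prems(2)[of f a] by (simp add: tdeg_add add_mono)
  qed simp
  show ?case
  proof (cases as)
    case (Cons x xs)
    obtain a b where ab: "m = a + b" "a \<in> keys (f ^ x)" "b \<in> keys (power_product fs xs)"
      using Cons.prems(1) keys_mult[of "f ^ x" "power_product fs xs"] unfolding Cons by auto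
    have "tdeg a \<le> x * D" using pow[OF ab(2)] .
    also have "x * D \<le> k * D" using Cons.prems(3)[of x] unfolding Cons by simp
    finally have "tdeg a \<le> k * D" .
    moreover have "tdeg b \<le> length fs * (k * D)"
    proof (rule Cons.IH[OF ab(3)])
      show "tdeg m \<le> D" if "g \<in> set fs" "m \<in> keys g" for g m
        using that by (intro Cons.prems(2)[of g]) simp_all
      show "a \<le> k" if "a \<in> set xs" for a
        using that Cons by (intro Cons.prems(3)) simp
    qed
    ultimately show ?thesis by (simp add: ab(1) tdeg_add)
  qed (use Cons.prems in simp)
qed simp

lemma exponent_le_of_power_bound:
  fixes E l d :: nat
  assumes "\<And>k. (k + 1) ^ l \<le> (E * (k + 1)) ^ d"
  shows "l \<le> d"
proof (rule ccontr)
  assume "\<not> l \<le> d"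
  \<comment> \<open>If \<open>l > d\<close>, the assumption gives \<open>k + 1 \<le> E ^ d\<close>
    for every \<open>k\<close>; this \<open>k\<close> refutes it.\<close>
  define k where "k = E ^ d"
  have "(k + 1) ^ Suc d \<le> (k + 1) ^ l"
    using \<open>\<not> l \<le> d\<close> by (intro power_increasing) auto
  also have "\<dots> \<le> E ^ d * (k + 1) ^ d"
    using assms[of k] by (simp only: power_mult_distrib)
  finally have "(k + 1) * (k + 1) ^ d \<le> k * (k + 1) ^ d" by (simp add: k_def)
  then have "k + 1 \<le> k" by (subst (asm) mult_le_cancel2) simp
  then show False by simp
qed

section \<open>Growth of the set of exponents, and the length of prime chains\<close>

context connected_bipartite_graph
begin

text \<open>Every edge has exactly one end in \<open>A\<close>. The sides are arbitrary here, so
  that the count also applies with \<open>A\<close> and \<open>B\<close> exchanged.\<close>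

lemma toric_exp_balanced:
  assumes AB: "A \<inter> B = {}" "finite A"
    and ed: "\<And>i. i \<in> {1..N} \<Longrightarrow> \<exists>p\<in>A. \<exists>q\<in>B. e i = {p, q}"
  shows "keys m \<subseteq> {1..N} \<Longrightarrow> (\<Sum>a\<in>A. lookup (toric_exp e m) a) = tdeg m"
proof (induction m rule: monomial_induct)
  case (add_var m i)
  have i: "i \<in> {1..N}" and m: "keys m \<subseteq> {1..N}"
    using add_var.prems by (simp_all add: keys_plus_monomial)
  obtain p q where pq: "p \<in> A" "q \<in> B" "e i = {p, q}" using ed[OF i] by blast
  have q: "q \<notin> A" using AB(1) pq(2) by blast
  then have "p \<noteq> q" using pq(1) by blast
  then have "lookup (toric_exp e (mvar i)) a = (if a = p then 1 else 0)" if "a \<in> A" for a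
    using that q unfolding toric_exp_edge[of e i p q, OF pq(3) \<open>p \<noteq> q\<close>]
    by (auto simp: lookup_add lookup_mvar)
  then have "(\<Sum>a\<in>A. lookup (toric_exp e (mvar i)) a) = 1"
    using pq(1) AB(2) by simp
  then show ?case using add_var.IH[OF m]
    by (simp add: toric_exp_add lookup_add sum.distrib tdeg_add)
qed simp

text \<open>
  Both sides of the bipartition have the same total exponent, so one coordinate is determined by the
  other \<open>v - 1\<close>.
\<close>

lemma card_toric_exps_le:
  "card {u. \<exists>m. keys m \<subseteq> {1..N} \<and> tdeg m \<le> M \<and> u = toric_exp e m} \<le> (M + 1) ^ (v - 1)"
    (is "card ?U \<le> _")
proof -
  obtain A B where dj: "A \<inter> B = {}" and un: "A \<union> B = {1..v}" and
    ed: "\<forall>i\<in>{1..N}. \<exists>p\<in>A. \<exists>q\<in>B. e i = {p, q}"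
    using bipartition by (elim exE conjE)
  have fin: "finite A" "finite B" using un finite_Un[of A B] by auto
  have "1 \<in> {1..N}" using at_least_one_edge by simp
  then obtain b0 where b0: "b0 \<in> B" using ed by blast
  have balA: "(\<Sum>a\<in>A. lookup (toric_exp e m) a) = tdeg m" if "keys m \<subseteq> {1..N}" for m
    using ed by (intro toric_exp_balanced[OF dj fin(1) _ that]) simp
  have balB: "(\<Sum>a\<in>B. lookup (toric_exp e m) a) = tdeg m" if "keys m \<subseteq> {1..N}" for m
  proof (rule toric_exp_balanced[OF _ fin(2) _ that])
    show "B \<inter> A = {}" using dj by (simp add: Int_commute)
    show "\<exists>p\<in>B. \<exists>q\<in>A. e i = {p, q}" if "i \<in> {1..N}" for i
      using bspec[OF ed that] insert_commute[of _ _ "{}"] by metis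
  qed
  let ?X = "{1..v} - {b0}"
  let ?r = "\<lambda>u. restrict (lookup u) ?X"
  have "inj_on ?r ?U"
  proof (rule inj_onI)
    fix u u' assume "u \<in> ?U" "u' \<in> ?U" and eq: "?r u = ?r u'"
    then obtain m m' where m: "keys m \<subseteq> {1..N}" "u = toric_exp e m" "keys m' \<subseteq> {1..N}" "u' = toric_exp e m'"
      by auto
    have same: "lookup u a = lookup u' a" if "a \<in> ?X" for a
      using fun_cong[OF eq, of a] that by simp
    have "A \<subseteq> ?X" using un dj b0 by blast
    then have "(\<Sum>a\<in>A. lookup u a) = (\<Sum>a\<in>A. lookup u' a)"
      by (intro sum.cong refl same) blast
    then have "(\<Sum>a\<in>B. lookup u a) = (\<Sum>a\<in>B. lookup u' a)"
      using balA balB m by simp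
    moreover have "(\<Sum>a\<in>B - {b0}. lookup u a) = (\<Sum>a\<in>B - {b0}. lookup u' a)"
      using un by (intro sum.cong refl same) blast
    ultimately have "lookup u b0 = lookup u' b0"
      using fin(2) b0 by (simp add: sum.remove[of B b0])
    moreover have "lookup u a = lookup u' a" if "a \<notin> {1..v}" for a
      using that keys_toric_exp_subset[OF m(1)] keys_toric_exp_subset[OF m(3)] m(2,4)
      by (metis in_keys_iff subsetD)
    ultimately have "lookup u a = lookup u' a" for a
      using same[of a] by (cases "a = b0"; cases "a \<in> {1..v}") auto
    then show "u = u'" by (rule poly_mapping_eqI)
  qed
  moreover have "?r ` ?U \<subseteq> (\<Pi>\<^sub>E a\<in>?X. {..M})"
  proof (rule image_subsetI)
    fix u assume "u \<in> ?U"
    then obtain m where m: "keys m \<subseteq> {1..N}" "tdeg m \<le> M" "u = toric_exp e m" by blast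
    have "lookup u a \<le> M" if "a \<in> ?X" for a
    proof (cases "a \<in> A")
      case True
      then have "lookup u a \<le> (\<Sum>a\<in>A. lookup u a)" by (intro member_le_sum fin) auto
      then show ?thesis using balA[OF m(1)] m by simp
    next
      case False
      then have "a \<in> B" using that un by blast
      then have "lookup u a \<le> (\<Sum>a\<in>B. lookup u a)" by (intro member_le_sum fin) auto
      then show ?thesis using balB[OF m(1)] m by simp
    qed
    then show "?r u \<in> (\<Pi>\<^sub>E a\<in>?X. {..M})" by auto
  qed
  ultimately have "card ?U \<le> card (\<Pi>\<^sub>E a\<in>?X. {..M})"
    by (intro card_inj_on_le[of ?r]) (auto intro: finite_PiE)
  also have "\<dots> = (M + 1) ^ card ?X"
    by (simp add: card_PiE)
  also have "card ?X = v - 1"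
    using b0 un by (subst card_Diff_singleton) auto
  finally show ?thesis .
qed

text \<open>The chain is pulled back to the polynomial ring and a witness \<open>f i\<close> is
  chosen for each strict inclusion. The \<open>(k + 1) ^ l\<close> power products with exponents at
  most \<open>k\<close> have independent images, whose terms have exponents from a set of size at
  most a constant times \<open>(k + 1) ^ (v - 1)\<close>. Letting \<open>k\<close> grow gives the
  bound.\<close>

lemma prime_chain_length_le:
  assumes chain: "prime_chain_in (toric_ring v N e :: 'k::field mpoly set ring) \<mm> l p"
  shows "l \<le> v - 1"
proof -
  let ?P = "mpoly_ring N :: 'k mpoly ring"
  define Q where "Q i = {f \<in> carrier ?P. cls f \<in> p i}" for i
  have prime: "primeideal (Q i) ?P" if "i \<le> l" for i
    unfolding Q_def using chain that
    by (intro ring_hom_ring.primeideal_vimage[OF cls_ring_hom mpoly_ring_cring])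
      (simp add: prime_chain_in_def)
  have p_sub: "p i \<subseteq> carrier (toric_ring v N e)" if "i \<le> l" for i
    using chain that unfolding prime_chain_in_def
    by (meson additive_subgroup.a_subset ideal.axioms(1) primeideal.axioms(1))
  have ex: "\<exists>f. f \<in> Q (Suc i) \<and> f \<notin> Q i" if "i < l" for i
  proof -
    have "p i \<subset> p (Suc i)" using chain that by (simp add: prime_chain_in_def)
    then obtain X where X: "X \<in> p (Suc i)" "X \<notin> p i" by blast
    then have "X \<in> cls ` carrier ?P"
      using p_sub[of "Suc i"] that by (auto simp: toric_ring_carrier)
    then obtain f where "f \<in> carrier ?P" "X = cls f" by blast
    then show ?thesis using X by (auto simp: Q_def)
  qed
  define f where "f i = (SOME f. f \<in> Q (Suc i) \<and> f \<notin> Q i)" for i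
  have f: "f i \<in> Q (Suc i) \<and> f i \<notin> Q i" if "i < l" for i
    unfolding f_def using ex[OF that] by (rule someI_ex)
  have sub: "Q i \<subseteq> Q (Suc i)" if "i < l" for i
    using chain that by (auto simp: Q_def prime_chain_in_def)
  let ?fs = "map f [0..<l]"
  have fs: "set ?fs \<subseteq> carrier ?P" using f by (auto simp: Q_def)
  \<comment> \<open>Each pulled-back prime contains the kernel of \<open>toric_hom\<close>, so a
    linear relation between the images becomes membership in \<open>Q 0\<close>, as the independence
    lemma requires.\<close>
  have zero_Q: "g \<in> Q 0" if "g \<in> carrier ?P" "toric_hom e g = 0" for g
  proof -
    have "cls g = cls 0" using that cls_eq_iff[of g 0] by simp
    moreover have "0 \<in> Q 0"
      by (rule mpoly_ideal_closed(2)[OF primeideal.axioms(1)[OF prime]]) simp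
    ultimately show ?thesis using that(1) by (simp add: Q_def)
  qed
  obtain D where D: "\<And>g m. g \<in> set ?fs \<Longrightarrow> m \<in> keys g \<Longrightarrow> tdeg m \<le> D"
  proof -
    have "finite (\<Union>g\<in>set ?fs. tdeg ` keys g)" by auto
    then obtain D where "\<forall>x\<in>(\<Union>g\<in>set ?fs. tdeg ` keys g). x \<le> D"
      using finite_nat_set_iff_bounded_le by blast
    then show ?thesis using that by blast
  qed
  \<comment> \<open>Chosen so that \<open>l * (k * D) + 1 \<le> E * (k + 1)\<close>, with a constant
    \<open>E\<close> independent of \<open>k\<close>.\<close>
  define E where "E = l * D + 1"
  have "(k + 1) ^ l \<le> (E * (k + 1)) ^ (v - 1)" for k
  proof -
    let ?A = "{as. set as \<subseteq> {..k} \<and> length as = l}"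
    define M where "M = l * (k * D)"
    let ?U = "{u. \<exists>m. keys m \<subseteq> {1..N} \<and> tdeg m \<le> M \<and> u = toric_exp e m}"
    have finA: "finite ?A" by (rule finite_lists_length_eq) simp
    have "?U = toric_exp e ` (\<Union>j\<le>M. {m. keys m \<subseteq> {1..N} \<and> tdeg m = j})" by auto
    then have finU: "finite ?U" using finite_monomials_tdeg[of "{1..N}"] by simp
    have "card ?A \<le> card ?U"
    proof (rule independent_family_card_le[OF finA finU])
      fix as assume as: "as \<in> ?A"
      have "tdeg m \<le> M" if "m \<in> keys (power_product ?fs as)" for m
        using tdeg_power_product[of ?fs D as k m] D as that by (auto simp: M_def)
      moreover have "keys m \<subseteq> {1..N}" if "m \<in> keys (power_product ?fs as)" for m
        using power_product_closed[OF fs, of as] that by (simp add: mpoly_ring_carrier)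
      ultimately show "keys (toric_hom e (power_product ?fs as)) \<subseteq> ?U"
        using keys_toric_hom[of e "power_product ?fs as"] by blast
    next
      fix c :: "nat list \<Rightarrow> 'k"
      assume "(\<Sum>as\<in>?A. Const (c as) * toric_hom e (power_product ?fs as)) = 0"
      moreover have "toric_hom e (Const a * g) = Const a * toric_hom e g" for a :: 'k and g
        using toric_hom_single[of e 0 a] by (simp add: toric_hom_mult Const_def)
      moreover have "toric_hom e (sum g T) = (\<Sum>x\<in>T. toric_hom e (g x :: 'k mpoly))" for g and T :: "nat list set"
        by (simp add: toric_hom_eq lin_ext_sum)
      ultimately have "toric_hom e (\<Sum>as\<in>?A. Const (c as) * power_product ?fs as) = 0"
        by simp
      then have "(\<Sum>as\<in>?A. Const (c as) * power_product ?fs as) \<in> Q 0"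
        by (intro zero_Q mpoly_sum_closed mpoly_mult_closed power_product_closed[OF fs]) auto
      then show "\<forall>as\<in>?A. c as = 0"
        using f sub prime by (intro prime_chain_independent[of l Q N f ?A c] finA) auto
    qed
    moreover have "card ?A = (k + 1) ^ l"
      by (simp add: card_lists_length_eq)
    moreover have "M + 1 \<le> E * (k + 1)"
      by (simp add: M_def E_def algebra_simps)
    ultimately show ?thesis
      using card_toric_exps_le[of M] power_mono[of "M + 1" "E * (k + 1)" "v - 1"] by linarith
  qed
  then show ?thesis by (rule exponent_le_of_power_bound)
qed

end

section \<open>Lower bound for the Krull dimension\<close>

context connected_bipartite_graph
begin

text \<open>The kernel of the toric homomorphism followed by setting \<open>t\<^sub>a = 0\<close> for all \<open>a \<notin> W\<close>.\<close>

definition face_ideal :: "nat set \<Rightarrow> 'k::field mpoly set" where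
  "face_ideal W = {f \<in> carrier (mpoly_ring N). \<forall>u\<in>keys (toric_hom e f). \<not> keys u \<subseteq> W}"

text \<open>The support of a product lies in \<open>W\<close> exactly when both supports do, so
  deleting the monomials that leave \<open>W\<close> is multiplicative. The ideal is thus the
  preimage of zero under a homomorphism into a domain.\<close>

lemma primeideal_face_ideal: "primeideal (face_ideal W :: 'k::field mpoly set) (mpoly_ring N)"
proof -
  define g :: "monomial \<Rightarrow> 'k mpoly" where
    "g m = (if keys (toric_exp e m) \<subseteq> W then monom_of (toric_exp e m) else 0)" for m
  have hom: "ring_hom_ring (mpoly_ring N) (mpoly_ring v) (lin_ext g)"
  proof (rule mpoly_ring_hom_lin_ext)
    show "g (a + b) = g a * g b" for a b
      by (auto simp: g_def toric_exp_add keys_plus_monomial mult_single)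
    show "g m \<in> carrier (mpoly_ring v)" if "keys m \<subseteq> {1..N}" for m
      by (simp add: g_def mpoly_single_closed[OF keys_toric_exp_subset[OF that]])
  qed (simp add: g_def)
  have l: "lookup (lin_ext g f) u = (if keys u \<subseteq> W then lookup (toric_hom e f) u else 0)" for f u
  proof -
    have "lookup (lin_ext g f) u = (\<Sum>m\<in>keys f. if toric_exp e m = u \<and> keys u \<subseteq> W then lookup f m else 0)"
      unfolding lin_ext_def lookup_sum g_def
      by (rule sum.cong) (auto simp: lookup_single when_def)
    also have "\<dots> = (if keys u \<subseteq> W then lookup (toric_hom e f) u else 0)"
      by (simp add: lookup_toric_hom sum.inter_filter)
    finally show ?thesis .
  qed
  have "lin_ext g f = 0 \<longleftrightarrow> (\<forall>u\<in>keys (toric_hom e f). \<not> keys u \<subseteq> W)" for f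
  proof
    assume z: "lin_ext g f = 0"
    show "\<forall>u\<in>keys (toric_hom e f). \<not> keys u \<subseteq> W"
    proof (intro ballI notI)
      fix u assume "u \<in> keys (toric_hom e f)" "keys u \<subseteq> W"
      then show False using l[of f u] z by (simp add: in_keys_iff)
    qed
  next
    assume "\<forall>u\<in>keys (toric_hom e f). \<not> keys u \<subseteq> W"
    then have "lookup (lin_ext g f) u = lookup 0 u" for u unfolding l by (auto simp: in_keys_iff)
    then show "lin_ext g f = 0" by (rule poly_mapping_eqI)
  qed
  then have "face_ideal W = {f \<in> carrier (mpoly_ring N). lin_ext g f \<in> {\<zero>\<^bsub>mpoly_ring v\<^esub>}}"
    by (simp add: face_ideal_def)
  then show ?thesis
    using ring_hom_ring.primeideal_vimage[OF hom mpoly_ring_cring domain.zeroprimeideal[OF mpoly_ring_domain]]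
    by (simp only:)
qed

text \<open>Membership in the face ideal is a condition on the image under \<open>toric_hom\<close>
  only, hence independent of the representative.\<close>

lemma cls_mem_face_ideal_iff:
  fixes f :: "'k::field mpoly"
  assumes "f \<in> carrier (mpoly_ring N)"
  shows "cls f \<in> cls ` face_ideal W \<longleftrightarrow> f \<in> face_ideal W"
proof
  assume "cls f \<in> cls ` face_ideal W"
  then obtain g :: "'k mpoly" where g: "g \<in> face_ideal W" "cls f = cls g" by blast
  then have "toric_hom e f = toric_hom e g"
    using cls_eq_iff[OF assms, of g] by (simp add: face_ideal_def)
  then show "f \<in> face_ideal W" using g(1) assms by (simp add: face_ideal_def)
qed (rule imageI)

lemma primeideal_cls_face_ideal:
  "primeideal (cls ` face_ideal W :: 'k::field mpoly set set) (toric_ring v N e)"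
proof (rule primeidealI)
  interpret F: primeideal "face_ideal W :: 'k mpoly set" "mpoly_ring N" by (rule primeideal_face_ideal)
  show "ideal (cls ` face_ideal W :: 'k mpoly set set) (toric_ring v N e)"
    by (rule ring_hom_ring.ideal_image_surj[OF cls_ring_hom F.is_ideal]) (simp add: toric_ring_carrier)
  show "cring (toric_ring v N e :: 'k mpoly set ring)" by (rule toric_ring_cring)
  show "carrier (toric_ring v N e) \<noteq> (cls ` face_ideal W :: 'k mpoly set set)"
  proof
    assume eq: "carrier (toric_ring v N e) = (cls ` face_ideal W :: 'k mpoly set set)"
    have "f \<in> face_ideal W" if f: "f \<in> carrier (mpoly_ring N)" for f :: "'k mpoly"
    proof -
      have "cls f \<in> carrier (toric_ring v N e)"
        unfolding toric_ring_carrier using f by (rule imageI)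
      then show ?thesis using cls_mem_face_ideal_iff[OF f] by (simp only: eq)
    qed
    then have "carrier (mpoly_ring N) = (face_ideal W :: 'k mpoly set)" using F.Icarr by blast
    then show False using F.I_notcarr by simp
  qed
  fix a b :: "'k mpoly set"
  assume "a \<in> carrier (toric_ring v N e)" "b \<in> carrier (toric_ring v N e)"
    and ab: "a \<otimes>\<^bsub>toric_ring v N e\<^esub> b \<in> cls ` face_ideal W"
  then obtain f g where fg: "a = cls f" "f \<in> carrier (mpoly_ring N)" "b = cls g" "g \<in> carrier (mpoly_ring N)"
    unfolding toric_ring_carrier by blast
  then have "f * g \<in> face_ideal W"
    using ab cls_mem_face_ideal_iff[OF mpoly_mult_closed[OF fg(2,4)]] by (simp add: cls_simps(1))
  then have "f \<in> face_ideal W \<or> g \<in> face_ideal W"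
    using F.I_prime[OF fg(2,4)] by simp
  then show "a \<in> cls ` face_ideal W \<or> b \<in> cls ` face_ideal W"
    unfolding fg(1,3) by blast
qed

text \<open>The exponent \<open>0\<close> has empty support, which lies in every \<open>W\<close>;
  so no image of an element of the face ideal has a constant term.\<close>

lemma cls_face_ideal_subset_origin:
  "cls ` face_ideal W \<subseteq> (toric_origin v N e :: 'k::field mpoly set set)"
  unfolding toric_origin_eq
proof (rule image_subsetI)
  fix f :: "'k mpoly" assume f: "f \<in> face_ideal W"
  then have fc: "f \<in> carrier (mpoly_ring N)" by (simp add: face_ideal_def)
  have "2 * 1 \<le> tdeg u" if u: "u \<in> keys (toric_hom e f)" for u
  proof -
    obtain m where m: "m \<in> keys f" "u = toric_exp e m" using keys_toric_hom u by blast
    have "u \<noteq> 0" using f u by (auto simp: face_ideal_def)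
    then have "m \<noteq> 0" using m(2) by auto
    then have "1 \<le> tdeg m" using tdeg_eq_0_iff[of m] by linarith
    moreover have "keys m \<subseteq> {1..N}" using fc m(1) by (simp add: mpoly_ring_carrier)
    ultimately show ?thesis using m(2) tdeg_toric_exp[of m] by simp
  qed
  then show "cls f \<in> cls ` order_ge N 1" using cls_mem_order_ge_iff[OF fc, of 1] by blast
qed

lemma edge_leaving:
  assumes "W \<subseteq> {1..v}" "a \<in> W" "b \<in> {1..v}" "b \<notin> W"
  obtains i x y where "i \<in> {1..N}" "e i = {x, y}" "x \<in> W" "y \<in> {1..v}" "y \<notin> W"
proof -
  let ?G = "{(a, b). {a, b} \<in> e ` {1..N}}"
  have ab: "(a, b) \<in> ?G\<^sup>*" using connected[of a b] assms by blast
  have "\<exists>x y. (x, y) \<in> ?G \<and> x \<in> W \<and> y \<notin> W"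
  proof (rule ccontr)
    assume no: "\<not> ?thesis"
    from ab have "b \<in> W"
      by (induction rule: rtrancl_induct) (use assms(2) no in auto)
    then show False using assms(4) by simp
  qed
  then obtain x y i where xy: "x \<in> W" "y \<notin> W" "i \<in> {1..N}" "e i = {x, y}" by auto
  moreover have "y \<in> {1..v}" using edge[OF xy(3)] xy(4) by simp
  ultimately show ?thesis using that by simp
qed

lemma vertex_filtration:
  obtains W where "\<And>j. j < v - 1 \<Longrightarrow> W j \<subseteq> W (Suc j)"
    "\<And>j. j < v - 1 \<Longrightarrow> \<exists>i\<in>{1..N}. e i \<subseteq> W (Suc j) \<and> \<not> e i \<subseteq> W j"
proof -
  \<comment> \<open>Tracking the cardinality ensures that \<open>W\<close> does not exhaust the
    vertices before stage \<open>v - 1\<close>; the guards on \<open>n\<close> let the choice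
    continue trivially after that.\<close>
  let ?P = "\<lambda>n W. n \<le> v - 1 \<longrightarrow> W \<subseteq> {1..v} \<and> card W = Suc n"
  let ?Q = "\<lambda>n W W'. n < v - 1 \<longrightarrow> W \<subseteq> W' \<and> (\<exists>i\<in>{1..N}. e i \<subseteq> W' \<and> \<not> e i \<subseteq> W)"
  have "\<exists>W. \<forall>n. ?P n (W n) \<and> ?Q n (W n) (W (Suc n))"
  proof (rule dependent_nat_choice)
    have "1 \<in> {1..N}" using at_least_one_edge by simp
    then obtain p where "p \<in> {1..v}" by (rule edge_pair)
    then show "\<exists>W. ?P 0 W" by (intro exI[of _ "{p}"]) simp
  next
    fix W n assume W: "?P n W"
    show "\<exists>W'. ?P (Suc n) W' \<and> ?Q n W W'"
    proof (cases "n < v - 1")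
      case True
      then have W: "W \<subseteq> {1..v}" "card W = Suc n" using W by simp_all
      then obtain a where a: "a \<in> W" by fastforce
      have "W \<noteq> {1..v}" using W(2) True by auto
      then obtain b where b: "b \<in> {1..v}" "b \<notin> W" using W(1) by blast
      obtain i x y where i: "i \<in> {1..N}" "e i = {x, y}" "x \<in> W" "y \<in> {1..v}" "y \<notin> W"
        using edge_leaving[OF W(1) a b] .
      have "finite W" using W(1) finite_subset by blast
      then have "card (insert y W) = Suc (Suc n)" using W(2) i(5) by simp
      moreover have "\<exists>i\<in>{1..N}. e i \<subseteq> insert y W \<and> \<not> e i \<subseteq> W"
        using i by (intro bexI[of _ i]) simp_all
      ultimately show ?thesis
        using W(1) i(4) by (intro exI[of _ "insert y W"]) auto
    qed simp
  qed
  then obtain W where W: "\<forall>n. ?P n (W n) \<and> ?Q n (W n) (W (Suc n))" ..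
  show ?thesis
    by (rule that[of W]) (use W in blast)+
qed

lemma prime_chain_exists:
  "\<exists>p. prime_chain_in (toric_ring v N e :: 'k::field mpoly set ring) (toric_origin v N e) (v - 1) p"
proof -
  obtain W where mono: "\<And>j. j < v - 1 \<Longrightarrow> W j \<subseteq> W (Suc j)"
    and new: "\<And>j. j < v - 1 \<Longrightarrow> \<exists>i\<in>{1..N}. e i \<subseteq> W (Suc j) \<and> \<not> e i \<subseteq> W j"
    by (rule vertex_filtration) blast
  \<comment> \<open>The index is reversed because a larger vertex set gives a smaller ideal.\<close>
  define p :: "nat \<Rightarrow> 'k mpoly set set" where "p j = cls ` face_ideal (W (v - 1 - j))" for j
  have "p j \<subset> p (Suc j)" if j: "j < v - 1" for j
  proof -
    define j' where "j' = v - 1 - Suc j"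
    have j': "v - 1 - j = Suc j'" "j' < v - 1" using j by (simp_all add: j'_def)
    have "face_ideal (W (Suc j')) \<subseteq> (face_ideal (W j') :: 'k mpoly set)"
      using mono[OF j'(2)] by (auto simp: face_ideal_def)
    then have "p j \<subseteq> p (Suc j)"
      unfolding p_def j'(1) j'_def[symmetric] by (rule image_mono)
    \<comment> \<open>The variable of an edge that is newly contained in the larger vertex set
      witnesses strictness: its image survives there, but is killed on the smaller set.\<close>
    moreover obtain i where i: "i \<in> {1..N}" "e i \<subseteq> W (Suc j')" "\<not> e i \<subseteq> W j'"
      using new[OF j'(2)] by blast
    have Vc: "(Var i :: 'k mpoly) \<in> carrier (mpoly_ring N)"
      using i(1) unfolding Var_def by (intro mpoly_single_closed) simp
    have "keys (toric_exp e (mvar i)) = e i"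
      using keys_toric_exp[of "mvar i"] i(1) by simp
    then have "(Var i :: 'k mpoly) \<in> face_ideal W' \<longleftrightarrow> \<not> e i \<subseteq> W'" for W'
      using Vc by (simp add: face_ideal_def Var_def toric_hom_single)
    then have "cls (Var i) \<in> p (Suc j)" "cls (Var i) \<notin> p j"
      unfolding p_def j'(1) j'_def[symmetric] cls_mem_face_ideal_iff[OF Vc] using i by simp_all
    ultimately show ?thesis by blast
  qed
  then have "prime_chain_in (toric_ring v N e) (toric_origin v N e) (v - 1) p"
    unfolding prime_chain_in_def
    by (simp add: p_def primeideal_cls_face_ideal cls_face_ideal_subset_origin)
  then show ?thesis by (rule exI[of _ p])
qed

theorem krull_dim_toric_ring:
  "krull_dim_at (toric_ring v N e :: 'k::field mpoly set ring) (toric_origin v N e) = enat (v - 1)"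
  unfolding krull_dim_at_def
proof (rule antisym)
  show "Sup {enat l |l. \<exists>p. prime_chain_in (toric_ring v N e :: 'k mpoly set ring) (toric_origin v N e) l p} \<le> enat (v - 1)"
    by (rule Sup_least) (auto dest: prime_chain_length_le)
  show "enat (v - 1) \<le> Sup {enat l |l. \<exists>p. prime_chain_in (toric_ring v N e :: 'k mpoly set ring) (toric_origin v N e) l p}"
    using prime_chain_exists by (intro Sup_upper) blast
qed

end

section \<open>The multiplicity, from the Hilbert polynomial and the Krull dimension\<close>

theorem theorem1p3:
  fixes n v N :: nat and e :: "nat \<Rightarrow> nat set"
  assumes "connected_bipartite_graph v N e"
    and "generated_by_quadratic_binomials N (toric_ideal v N e :: 'k::field mpoly set)"
    and "good_graph N e"
    and "card (four_cycles N e) = n"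
    and "v = 2 * n + 2"
    and "N = 3 * n + 1"
  shows "has_hilbert_samuel_multiplicity
           (toric_ring v N e :: 'k mpoly set ring)
           (toric_constants v N e) (toric_origin v N e) (2 ^ n)"
proof -
  interpret connected_bipartite_graph v N e by (rule assms(1))
  obtain Z where Z: "finite Z" "card Z = n" "\<Union>Z \<subseteq> {1..N}" "pairwise disjnt Z"
    "\<And>p. p \<in> Z \<Longrightarrow> card p = 2"
    and card: "\<And>k. card (toric_exps N e k) = card (std_monomials {1..N} Z k)"
    using card_toric_exps[OF assms(2,3)] assms(4) by metis
  \<comment> \<open>The degree bound \<open>2 * n\<close> comes from the edges:
    \<open>3 * n + 1 = Suc (n + 2 * n)\<close>.\<close>
  have "\<exists>P :: rat poly. Polynomial.degree P \<le> 2 * n \<and> Polynomial.coeff P (2 * n) = 2 ^ card Z / fact (2 * n) \<and>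
     (\<forall>k\<ge>card Z. of_nat (card (std_monomials {1..N} Z k)) = poly P (of_nat k))"
    by (rule card_std_monomials_poly) (use Z assms(6) in auto)
  then obtain P :: "rat poly" where P: "Polynomial.coeff P (2 * n) = 2 ^ n / fact (2 * n)"
    "\<And>k. k \<ge> n \<Longrightarrow> of_nat (card (toric_exps N e k)) = poly P (of_nat k)"
    using Z(2) card by auto
  show ?thesis
    unfolding has_hilbert_samuel_multiplicity_def
  proof (intro exI conjI allI impI)
    \<comment> \<open>Here the vertices yield the same \<open>d\<close>:
      \<open>v - 1 = 2 * n + 1\<close> is one more than the degree of the Hilbert
      polynomial.\<close>
    show "krull_dim_at (toric_ring v N e :: 'k mpoly set ring) (toric_origin v N e) = enat (2 * n + 1)"
      using krull_dim_toric_ring assms(5) by simp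
    show "graded_piece_dimension (toric_ring v N e :: 'k mpoly set ring) (toric_constants v N e)
        (toric_origin v N e) k (card (toric_exps N e k))" for k
      by (rule graded_piece_dimension_toric)
    show "of_nat (card (toric_exps N e k)) = poly P (of_nat k)" if "n \<le> k" for k
      using that by (rule P(2))
    show "of_nat (2 ^ n) = fact (2 * n) * Polynomial.coeff P (2 * n)"
      by (simp add: P(1))
  qed
qed

end
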